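(* Let $(E,\langle\cdot,\cdot\rangle)$ be a $\mathcal{T}_{c}$-complete random inner product module over $K$ with base $(\Omega,\mathcal{F},P)$ such that $E$ has the countable concatenation property. Then for every $f\in E^{*}$ there exists a unique $\pi(f)\in E$ such that $f(x)=\langle x,\pi(f)\rangle$ for all $x\in E$, and such that $\|f\|^{*}=\|\pi(f)\|$. Finally, the induced mapping $\pi:E^{*}\to E$ is a surjective conjugate isomorphism, namely $\pi$ is a bijection with $\pi(\xi f+\eta g)=\bar{\xi}\pi(f)+\bar{\eta}\pi(g)$ for all $\xi,\eta\in L^{0}(\mathcal{F},K)$ and $f,g\in E^{*}$.
   Context: $(\Omega,\mathcal{F},P)$ is a probability space, $K=\mathbb{R}$ or $\mathbb{C}$, and $L^{0}(\mathcal{F},K)$ is the algebra of equivalence classes (under a.s. equality) of $K$-valued $\mathcal{F}$-measurable functions; $L^0(\mathcal F,\mathbb R)$ has a.s. pointwise order and $\wedge$ denotes lattice infimum. $L^0_+=\{\xi\in L^0(\mathcal F,\mathbb R):\xi\ge 0\}$; $L^0_{++}$ is the set of $\xi\in L^0_+$ with $\xi>0$ a.s. on $\Omega$. $\tilde I_A$ is the class of the indicator of $A\in\mathcal F$. A random inner product module over $K$ with base $(\Omega,\mathcal F,P)$ is a left $L^0(\mathcal F,K)$-module $E$ with a map $\langle\cdot,\cdot\rangle:E\times E\to L^0(\mathcal F,K)$ such that: $\langle x,x\rangle\in L^0_+$, and $\langle x,x\rangle=0$ iff $x=\theta$; $\langle x,y\rangle=\overline{\langle y,x\rangle}$; $\langle\xi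 x,y\rangle=\xi\langle x,y\rangle$ for $\xi\in L^0(\mathcal F,K)$; $\langle x+y,z\rangle=\langle x,z\rangle+\langle y,z\rangle$. Put $\|x\|=\sqrt{\langle x,x\rangle}$; this is an $L^0$-norm, i.e. $\|\cdot\|:E\to L^0_+$, $\|\xi x\|=|\xi|\|x\|$, $\|x+y\|\le\|x\|+\|y\|$, and $\|x\|=0$ iff $x=\theta$. $\mathcal T_c$ is the topology on $E$ in which $G\subset E$ is open iff for every $x\in G$ there is $\varepsilon\in L^0_{++}$ with $x+\{y:\|y\|\le\varepsilon\}\subset G$; completeness means every Cauchy net converges. $L^0(\mathcal F,K)$ carries the $\mathcal T_c$ induced by $|\cdot|$. $E^*$ is the $L^0(\mathcal F,K)$-module of $\mathcal T_c$-continuous module homomorphisms $f:E\to L^0(\mathcal F,K)$ (equivalently, those with $|f(x)|\le\xi\|x\|$ for all $x$, for some $\xi\in L^0_+$), and $\|f\|^*=\wedge\{\xi\in L^0_+:|f(x)|\le\xi\|x\|\ \forall x\in E\}$. $E$ has the countable concatenation property if for every sequence $\{x_n\}$ in $E$ and every countable partition $\{A_n\}$ of $\Omega$ into members of $\mathcal F$ there is $x\in E$ with $\tilde I_{A_n}x=\tilde I_{A_n}x_n$ for all $n$. *)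

theory Defs
  imports "HOL-Probability.Probability" "HOL-Algebra.Module" "HOL-Algebra.Lattice"
begin

section \<open>The scalar field\<close>

text \<open>
  \<open>K\<close> is \<open>\<real>\<close> or \<open>\<complex>\<close>: both are instances of the following class, and the lemma
  \<open>real_or_complex_cases\<close> below shows that up to isomorphism there are no others.
  \<open>sc_conj\<close> is complex conjugation (the identity on \<open>\<real>\<close>), \<open>sc_re\<close> the real part.
\<close>

class real_or_complex = real_normed_field + second_countable_topology +
  fixes sc_conj :: "'a \<Rightarrow> 'a" and sc_re :: "'a \<Rightarrow> real"
  assumes sc_conj_add: "sc_conj (x + y) = sc_conj x + sc_conj y"
    and sc_conj_mult: "sc_conj (x * y) = sc_conj x * sc_conj y"
    and mult_sc_conj_scaleR: "x * sc_conj x = (norm x)\<^sup>2 *\<^sub>R 1"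
    and add_sc_conj_scaleR: "x + sc_conj x = (2 * sc_re x) *\<^sub>R 1"

lemma mult_sc_conj: "x * sc_conj x = of_real ((norm x)\<^sup>2)"
  and add_sc_conj: "x + sc_conj x = of_real (2 * sc_re x)" for x :: "'k::real_or_complex"
  by (simp_all add: of_real_def mult_sc_conj_scaleR add_sc_conj_scaleR)

instantiation real :: real_or_complex
begin
definition "sc_conj (x::real) = x"
definition "sc_re (x::real) = x"
instance
  by standard (auto simp: sc_conj_real_def sc_re_real_def power2_eq_square)
end

instantiation complex :: real_or_complex
begin
definition "sc_conj (z::complex) = cnj z"
definition "sc_re (z::complex) = Re z"
instance
  by standard (auto simp: sc_conj_complex_def sc_re_complex_def complex_add_cnj
      scaleR_conv_of_real simp flip: complex_norm_square)
end

lemma sc_conj_of_real [simp]: "sc_conj (of_real r :: 'k::real_or_complex) = of_real r"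
proof -
  have "(of_real r :: 'k) * sc_conj (of_real r) = of_real r * of_real r"
    by (simp add: mult_sc_conj power2_eq_square)
  moreover have "sc_conj (0::'k) = 0"
    using sc_conj_add[of "0::'k" 0] by simp
  ultimately show ?thesis by (cases "r = 0") auto
qed

lemma sc_re_of_real [simp]: "sc_re (of_real r :: 'k::real_or_complex) = r"
proof -
  have "(of_real (2 * r) :: 'k) = of_real (2 * sc_re (of_real r :: 'k))"
    using add_sc_conj[of "of_real r :: 'k"] by simp
  then show ?thesis by (simp only: of_real_eq_iff)
qed

lemma real_or_complex_cases:
  shows "(\<forall>z::'k::real_or_complex. z = of_real (sc_re z) \<and> sc_conj z = z) \<or>
    (\<exists>i::'k. i * i = -1 \<and> (\<forall>z::'k. \<exists>b::real. z = of_real (sc_re z) + of_real b * i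
        \<and> sc_conj z = of_real (sc_re z) - of_real b * i))"
proof (cases "\<forall>z::'k. z = of_real (sc_re z)")
  case True
  then show ?thesis by (metis sc_conj_of_real)
next
  case False
  define im where "im z = z - of_real (sc_re z)" for z :: 'k
  have im_conj: "sc_conj (im z) = - im z" for z
  proof -
    have "sc_conj z = sc_conj (im z) + of_real (sc_re z)"
      unfolding im_def by (metis diff_add_cancel sc_conj_add sc_conj_of_real)
    moreover have "sc_conj z = 2 * of_real (sc_re z) - z"
      using add_sc_conj[of z] by (simp add: algebra_simps)
    ultimately show ?thesis by (simp add: im_def algebra_simps)
  qed
  from False obtain z0 where z0: "im z0 \<noteq> 0" by (auto simp: im_def)
  define i where "i = of_real (inverse (norm (im z0))) * im z0"
  have ic: "sc_conj i = - i"
    by (simp only: i_def sc_conj_mult sc_conj_of_real im_conj) simp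
  have "norm i = 1" using z0 by (simp add: i_def norm_mult norm_inverse)
  then have ii: "i * i = -1"
    using mult_sc_conj[of i] ic by (simp add: minus_equation_iff)
  have "\<exists>b::real. z = of_real (sc_re z) + of_real b * i
      \<and> sc_conj z = of_real (sc_re z) - of_real b * i" for z
  proof -
    let ?w = "- (im z * i)"
    have "sc_conj ?w = ?w"
    proof -
      have "sc_conj (-1::'k) = -1" using sc_conj_of_real[of "-1", where 'k='k] by simp
      then have "sc_conj (-1 * (im z * i)) = -1 * (im z * i)"
        by (simp only: sc_conj_mult im_conj ic) simp
      then show ?thesis by simp
    qed
    then have "2 * ?w = 2 * of_real (sc_re ?w)" using add_sc_conj[of ?w]
      by (simp only: mult_2 of_real_add)
    then have w: "?w = of_real (sc_re ?w)" by (metis mult_cancel_left zero_neq_numeral)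
    have "?w * i = - (im z * (i * i))" by (simp add: mult.assoc)
    then have iz: "im z = ?w * i" using ii by simp
    then have "im z = of_real (sc_re ?w) * i" using w by metis
    moreover have "sc_conj z = of_real (sc_re z) - im z"
      using add_sc_conj[of z] by (simp add: im_def algebra_simps)
    ultimately have "z = of_real (sc_re z) + of_real (sc_re ?w) * i
      \<and> sc_conj z = of_real (sc_re z) - of_real (sc_re ?w) * i"
      by (metis im_def add.commute diff_add_cancel)
    then show ?thesis by blast
  qed
  with ii show ?thesis by blast
qed


section \<open>The algebra of equivalence classes of measurable functions\<close>

text \<open>
  Classes are taken inside the Borel measurable functions on \<open>M\<close>. Values outside
  \<open>space M\<close> are irrelevant both to measurability and to almost sure equality.
\<close>

definition L0_cls :: "'w measure \<Rightarrow> ('w \<Rightarrow> 'b::topological_space) \<Rightarrow> ('w \<Rightarrow> 'b) set" where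
  "L0_cls M f = {g \<in> borel_measurable M. AE w in M. f w = g w}"

text \<open>An arbitrary representative; everything below depends on it only up to null sets.\<close>

definition L0_rep :: "('w \<Rightarrow> 'b) set \<Rightarrow> 'w \<Rightarrow> 'b" where
  "L0_rep X = (SOME f. f \<in> X)"

definition L0_map :: "'w measure \<Rightarrow> ('a \<Rightarrow> 'b::topological_space) \<Rightarrow> ('w \<Rightarrow> 'a) set \<Rightarrow> ('w \<Rightarrow> 'b) set"
  where "L0_map M h X = L0_cls M (\<lambda>w. h (L0_rep X w))"

definition L0 :: "'w measure \<Rightarrow> ('w \<Rightarrow> 'k::real_or_complex) set ring" where
  "L0 M = \<lparr>carrier = L0_cls M ` borel_measurable M,
     mult = (\<lambda>X Y. L0_cls M (\<lambda>w. L0_rep X w * L0_rep Y w)),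
     one = L0_cls M (\<lambda>_. 1),
     zero = L0_cls M (\<lambda>_. 0),
     add = (\<lambda>X Y. L0_cls M (\<lambda>w. L0_rep X w + L0_rep Y w))\<rparr>"

abbreviation L0_conj :: "'w measure \<Rightarrow> ('w \<Rightarrow> 'k::real_or_complex) set \<Rightarrow> ('w \<Rightarrow> 'k) set" where
  "L0_conj M \<equiv> L0_map M sc_conj"

abbreviation L0_abs :: "'w measure \<Rightarrow> ('w \<Rightarrow> 'k::real_or_complex) set \<Rightarrow> ('w \<Rightarrow> real) set" where
  "L0_abs M \<equiv> L0_map M norm"

abbreviation L0_of_real :: "'w measure \<Rightarrow> ('w \<Rightarrow> real) set \<Rightarrow> ('w \<Rightarrow> 'k::real_or_complex) set" where
  "L0_of_real M \<equiv> L0_map M of_real"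

definition L0_le :: "'w measure \<Rightarrow> ('w \<Rightarrow> real) set \<Rightarrow> ('w \<Rightarrow> real) set \<Rightarrow> bool" where
  "L0_le M X Y \<longleftrightarrow> (AE w in M. L0_rep X w \<le> L0_rep Y w)"

definition L0_order :: "'w measure \<Rightarrow> ('w \<Rightarrow> real) set gorder" where
  "L0_order M = \<lparr>carrier = carrier (L0 M), eq = (=), le = L0_le M\<rparr>"

definition L0_plus :: "'w measure \<Rightarrow> ('w \<Rightarrow> real) set set" where
  "L0_plus M = {\<xi> \<in> carrier (L0 M). L0_le M \<zero>\<^bsub>L0 M\<^esub> \<xi>}"

definition L0_pp :: "'w measure \<Rightarrow> ('w \<Rightarrow> real) set set" where
  "L0_pp M = {\<xi> \<in> L0_plus M. AE w in M. 0 < L0_rep \<xi> w}"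

lemma L0_cls_self: "f \<in> borel_measurable M \<Longrightarrow> f \<in> L0_cls M f"
  by (simp add: L0_cls_def)

lemma L0_cls_eqI:
  assumes "AE w in M. f w = g w"
  shows "L0_cls M f = L0_cls M g"
proof -
  have "(AE w in M. f w = h w) \<longleftrightarrow> (AE w in M. g w = h w)" for h
    using assms by (auto elim: eventually_elim2)
  then show ?thesis by (simp add: L0_cls_def)
qed

lemma L0_rep_cls:
  assumes "f \<in> borel_measurable M"
  shows "L0_rep (L0_cls M f) \<in> borel_measurable M"
    and "AE w in M. L0_rep (L0_cls M f) w = f w"
proof -
  have "L0_rep (L0_cls M f) \<in> L0_cls M f"
    unfolding L0_rep_def using L0_cls_self[OF assms] by (rule someI[of "\<lambda>g. g \<in> L0_cls M f"])
  then show "L0_rep (L0_cls M f) \<in> borel_measurable M"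
    and "AE w in M. L0_rep (L0_cls M f) w = f w"
    by (auto simp: L0_cls_def elim: eventually_mono)
qed

lemma L0_carrierE:
  assumes "X \<in> carrier (L0 M)"
  obtains f where "f \<in> borel_measurable M" "X = L0_cls M f"
  using assms by (auto simp: L0_def)

lemma L0_cls_carrier: "f \<in> borel_measurable M \<Longrightarrow> L0_cls M f \<in> carrier (L0 M)"
  by (simp add: L0_def)

lemma L0_mult_cls:
  assumes "f \<in> borel_measurable M" "g \<in> borel_measurable M"
  shows "L0_cls M f \<otimes>\<^bsub>L0 M\<^esub> L0_cls M g = L0_cls M (\<lambda>w. f w * g w)"
  using L0_rep_cls(2)[OF assms(1)] L0_rep_cls(2)[OF assms(2)]
  by (auto simp: L0_def intro!: L0_cls_eqI)

lemma L0_add_cls: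
  assumes "f \<in> borel_measurable M" "g \<in> borel_measurable M"
  shows "L0_cls M f \<oplus>\<^bsub>L0 M\<^esub> L0_cls M g = L0_cls M (\<lambda>w. f w + g w)"
  using L0_rep_cls(2)[OF assms(1)] L0_rep_cls(2)[OF assms(2)]
  by (auto simp: L0_def intro!: L0_cls_eqI)

lemma L0_zero: "\<zero>\<^bsub>L0 M\<^esub> = L0_cls M (\<lambda>_. 0)" and L0_one: "\<one>\<^bsub>L0 M\<^esub> = L0_cls M (\<lambda>_. 1)"
  by (simp_all add: L0_def)

lemma cring_L0: "cring (L0 M :: ('w \<Rightarrow> 'k::real_or_complex) set ring)" (is "cring ?R")
proof -
  have ex: "\<exists>f. f \<in> borel_measurable M \<and> X = L0_cls M f" if "X \<in> carrier ?R" for X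
    using that by (auto simp: L0_def)
  have meas: "(\<lambda>w. f w + g w) \<in> borel_measurable M" "(\<lambda>w. f w * g w) \<in> borel_measurable M"
    if "f \<in> borel_measurable M" "g \<in> borel_measurable M" for f g :: "'w \<Rightarrow> 'k"
    using that by measurable
  note c = L0_cls_carrier L0_mult_cls L0_add_cls L0_zero L0_one meas
  show ?thesis
  proof (rule cringI)
    show "abelian_group ?R"
    proof (rule abelian_groupI)
      fix X assume "X \<in> carrier ?R"
      then obtain f where f [measurable]: "f \<in> borel_measurable M" and X: "X = L0_cls M f"
        using ex by blast
      show "\<exists>Y\<in>carrier ?R. Y \<oplus>\<^bsub>?R\<^esub> X = \<zero>\<^bsub>?R\<^esub>"
        by (rule bexI[of _ "L0_cls M (\<lambda>w. - f w)"]) (simp_all add: X c)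
      show "\<zero>\<^bsub>?R\<^esub> \<oplus>\<^bsub>?R\<^esub> X = X" by (simp add: X c)
    next
      fix X Y assume "X \<in> carrier ?R" "Y \<in> carrier ?R"
      then show "X \<oplus>\<^bsub>?R\<^esub> Y \<in> carrier ?R" "X \<oplus>\<^bsub>?R\<^esub> Y = Y \<oplus>\<^bsub>?R\<^esub> X"
        by (auto dest!: ex simp: c add.commute)
    next
      fix X Y Z assume "X \<in> carrier ?R" "Y \<in> carrier ?R" "Z \<in> carrier ?R"
      then show "X \<oplus>\<^bsub>?R\<^esub> Y \<oplus>\<^bsub>?R\<^esub> Z = X \<oplus>\<^bsub>?R\<^esub> (Y \<oplus>\<^bsub>?R\<^esub> Z)"
        by (auto dest!: ex simp: c add.assoc)
    qed (simp add: c)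
    show "Group.comm_monoid ?R"
    proof (rule comm_monoidI)
      fix X assume "X \<in> carrier ?R"
      then show "\<one>\<^bsub>?R\<^esub> \<otimes>\<^bsub>?R\<^esub> X = X" by (auto dest!: ex simp: c)
    next
      fix X Y assume "X \<in> carrier ?R" "Y \<in> carrier ?R"
      then show "X \<otimes>\<^bsub>?R\<^esub> Y \<in> carrier ?R" "X \<otimes>\<^bsub>?R\<^esub> Y = Y \<otimes>\<^bsub>?R\<^esub> X"
        by (auto dest!: ex simp: c mult.commute)
    next
      fix X Y Z assume "X \<in> carrier ?R" "Y \<in> carrier ?R" "Z \<in> carrier ?R"
      then show "X \<otimes>\<^bsub>?R\<^esub> Y \<otimes>\<^bsub>?R\<^esub> Z = X \<otimes>\<^bsub>?R\<^esub> (Y \<otimes>\<^bsub>?R\<^esub> Z)"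
        by (auto dest!: ex simp: c mult.assoc)
    qed (simp add: c)
    fix X Y Z assume "X \<in> carrier ?R" "Y \<in> carrier ?R" "Z \<in> carrier ?R"
    then show "(X \<oplus>\<^bsub>?R\<^esub> Y) \<otimes>\<^bsub>?R\<^esub> Z = X \<otimes>\<^bsub>?R\<^esub> Z \<oplus>\<^bsub>?R\<^esub> Y \<otimes>\<^bsub>?R\<^esub> Z"
      by (auto dest!: ex simp: c distrib_right)
  qed
qed


section \<open>Random inner product modules\<close>

locale random_inner_product_module =
  prob_space M + Module.module "L0 M" E
  for M :: "'w measure" and E :: "(('w \<Rightarrow> 'k::real_or_complex) set, 'e) module" +
  fixes ip :: "'e \<Rightarrow> 'e \<Rightarrow> ('w \<Rightarrow> 'k) set"
  assumes ip_closed: "\<lbrakk>x \<in> carrier E; y \<in> carrier E\<rbrakk> \<Longrightarrow> ip x y \<in> carrier (L0 M)"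
    and ip_nonneg: "x \<in> carrier E \<Longrightarrow> ip x x \<in> L0_of_real M ` L0_plus M"
    and ip_eq_zero_iff: "x \<in> carrier E \<Longrightarrow> ip x x = \<zero>\<^bsub>L0 M\<^esub> \<longleftrightarrow> x = \<zero>\<^bsub>E\<^esub>"
    and ip_conj: "\<lbrakk>x \<in> carrier E; y \<in> carrier E\<rbrakk> \<Longrightarrow> ip x y = L0_conj M (ip y x)"
    and ip_smult: "\<lbrakk>\<xi> \<in> carrier (L0 M); x \<in> carrier E; y \<in> carrier E\<rbrakk>
      \<Longrightarrow> ip (\<xi> \<odot>\<^bsub>E\<^esub> x) y = \<xi> \<otimes>\<^bsub>L0 M\<^esub> ip x y"
    and ip_add: "\<lbrakk>x \<in> carrier E; y \<in> carrier E; z \<in> carrier E\<rbrakk>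
      \<Longrightarrow> ip (x \<oplus>\<^bsub>E\<^esub> y) z = ip x z \<oplus>\<^bsub>L0 M\<^esub> ip y z"

text \<open>
  \<open>ip x x\<close> is the class of a nonnegative real function, but its type is that of
  \<open>K\<close>-valued classes; hence the \<open>sc_re\<close>.
\<close>

definition ip_norm ::
    "'w measure \<Rightarrow> ('e \<Rightarrow> 'e \<Rightarrow> ('w \<Rightarrow> 'k::real_or_complex) set) \<Rightarrow> 'e \<Rightarrow> ('w \<Rightarrow> real) set" where
  "ip_norm M ip x = L0_map M (\<lambda>z. sqrt (sc_re z)) (ip x x)"

definition countable_concatenation ::
    "'w measure \<Rightarrow> (('w \<Rightarrow> 'k::real_or_complex) set, 'e) module \<Rightarrow> bool" where
  "countable_concatenation M E \<longleftrightarrow>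
     (\<forall>x A. range x \<subseteq> carrier E \<longrightarrow> range A \<subseteq> sets M \<longrightarrow> disjoint_family A \<longrightarrow>
        (\<Union>n::nat. A n) = space M \<longrightarrow>
        (\<exists>y\<in>carrier E. \<forall>n. L0_cls M (indicator (A n)) \<odot>\<^bsub>E\<^esub> y
                           = L0_cls M (indicator (A n)) \<odot>\<^bsub>E\<^esub> x n))"


section \<open>The locally $L^0$-convex topology\<close>

text \<open>
  \<open>E\<close> is a ring scheme so that the definition applies both to modules and to \<open>L0 M\<close> itself;
  only the carrier and the addition matter.
\<close>

definition Tc_open ::
    "'w measure \<Rightarrow> ('e, 'm) ring_scheme \<Rightarrow> ('e \<Rightarrow> ('w \<Rightarrow> real) set) \<Rightarrow> 'e set \<Rightarrow> bool" where
  "Tc_open M E nrm G \<longleftrightarrow> G \<subseteq> carrier E \<and>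
     (\<forall>x\<in>G. \<exists>\<epsilon>\<in>L0_pp M. {x \<oplus>\<^bsub>E\<^esub> y |y. y \<in> carrier E \<and> L0_le M (nrm y) \<epsilon>} \<subseteq> G)"

definition Tc :: "'w measure \<Rightarrow> ('e, 'm) ring_scheme \<Rightarrow> ('e \<Rightarrow> ('w \<Rightarrow> real) set) \<Rightarrow> 'e topology" where
  "Tc M E nrm = topology (Tc_open M E nrm)"

lemma L0_pp_min:
  assumes "\<epsilon> \<in> L0_pp M" "\<delta> \<in> L0_pp M"
  obtains \<gamma> where "\<gamma> \<in> L0_pp M" "L0_le M \<gamma> \<epsilon>" "L0_le M \<gamma> \<delta>"
proof -
  from assms obtain f g where
    f [measurable]: "f \<in> borel_measurable M" and e: "\<epsilon> = L0_cls M f" and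
    g [measurable]: "g \<in> borel_measurable M" and d: "\<delta> = L0_cls M g"
    unfolding L0_pp_def L0_plus_def by (auto elim!: L0_carrierE)
  define h where "h w = min (f w) (g w)" for w
  have h [measurable]: "h \<in> borel_measurable M" unfolding h_def by measurable
  note r = L0_rep_cls(2)[OF f] L0_rep_cls(2)[OF g] L0_rep_cls(2)[OF h]
    L0_rep_cls(2)[OF borel_measurable_const[of "0::real" M]]
  have "AE w in M. 0 < L0_rep \<epsilon> w" "AE w in M. 0 < L0_rep \<delta> w"
    using assms by (auto simp: L0_pp_def)
  then have p: "AE w in M. 0 < h w"
    unfolding e d using r(1,2) by eventually_elim (simp add: h_def)
  show thesis
  proof
    have "L0_cls M h \<in> carrier (L0 M)" by (rule L0_cls_carrier) (rule h)
    moreover have "AE w in M. 0 < L0_rep (L0_cls M h) w" using r(3) p by eventually_elim simp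
    moreover have "L0_le M \<zero>\<^bsub>L0 M\<^esub> (L0_cls M h)"
      unfolding L0_le_def L0_zero using r(3,4) p by eventually_elim simp
    ultimately show "L0_cls M h \<in> L0_pp M" by (simp add: L0_pp_def L0_plus_def)
    show "L0_le M (L0_cls M h) \<epsilon>" "L0_le M (L0_cls M h) \<delta>"
      unfolding L0_le_def e d using r(1-3) by (eventually_elim, simp add: h_def)+
  qed
qed

lemma L0_le_trans: "L0_le M X Y \<Longrightarrow> L0_le M Y Z \<Longrightarrow> L0_le M X Z"
  unfolding L0_le_def by (auto elim: eventually_elim2)

lemma istopology_Tc_open: "istopology (Tc_open M E nrm)"
  unfolding istopology_def
proof (intro conjI allI impI)
  fix S T assume S: "Tc_open M E nrm S" and T: "Tc_open M E nrm T"
  show "Tc_open M E nrm (S \<inter> T)"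
    unfolding Tc_open_def
  proof (intro conjI ballI)
    show "S \<inter> T \<subseteq> carrier E" using S by (auto simp: Tc_open_def)
    fix x assume x: "x \<in> S \<inter> T"
    obtain \<epsilon> where e: "\<epsilon> \<in> L0_pp M" "{x \<oplus>\<^bsub>E\<^esub> y |y. y \<in> carrier E \<and> L0_le M (nrm y) \<epsilon>} \<subseteq> S"
      using x S by (auto simp: Tc_open_def)
    obtain \<delta> where d: "\<delta> \<in> L0_pp M" "{x \<oplus>\<^bsub>E\<^esub> y |y. y \<in> carrier E \<and> L0_le M (nrm y) \<delta>} \<subseteq> T"
      using x T by (auto simp: Tc_open_def)
    obtain \<gamma> where "\<gamma> \<in> L0_pp M" "L0_le M \<gamma> \<epsilon>" "L0_le M \<gamma> \<delta>"
      using L0_pp_min[OF e(1) d(1)] .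
    then show "\<exists>\<epsilon>\<in>L0_pp M. {x \<oplus>\<^bsub>E\<^esub> y |y. y \<in> carrier E \<and> L0_le M (nrm y) \<epsilon>} \<subseteq> S \<inter> T"
      using e(2) d(2) by (blast intro: L0_le_trans)
  qed
next
  fix \<K> assume "\<forall>K\<in>\<K>. Tc_open M E nrm K"
  then show "Tc_open M E nrm (\<Union>\<K>)" unfolding Tc_open_def by (meson Sup_le_iff UnionE Union_upper order_trans)
qed

lemma openin_Tc: "openin (Tc M E nrm) = Tc_open M E nrm"
  unfolding Tc_def by (rule topology_inverse'[OF istopology_Tc_open])


section \<open>Nets and completeness\<close>

definition directed_on :: "'i set \<Rightarrow> ('i \<Rightarrow> 'i \<Rightarrow> bool) \<Rightarrow> bool" where
  "directed_on D pre \<longleftrightarrow> D \<noteq> {} \<and> (\<forall>i\<in>D. pre i i)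
     \<and> (\<forall>i\<in>D. \<forall>j\<in>D. \<forall>k\<in>D. pre i j \<longrightarrow> pre j k \<longrightarrow> pre i k)
     \<and> (\<forall>i\<in>D. \<forall>j\<in>D. \<exists>k\<in>D. pre i k \<and> pre j k)"

definition net_converges ::
    "'e topology \<Rightarrow> 'i set \<Rightarrow> ('i \<Rightarrow> 'i \<Rightarrow> bool) \<Rightarrow> ('i \<Rightarrow> 'e) \<Rightarrow> 'e \<Rightarrow> bool" where
  "net_converges X D pre x l \<longleftrightarrow> l \<in> topspace X \<and>
     (\<forall>U. openin X U \<and> l \<in> U \<longrightarrow> (\<exists>i\<in>D. \<forall>j\<in>D. pre i j \<longrightarrow> x j \<in> U))"

definition Tc_Cauchy_net ::
    "'w measure \<Rightarrow> ('e, 'm) ring_scheme \<Rightarrow> ('e \<Rightarrow> ('w \<Rightarrow> real) set)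
      \<Rightarrow> 'i set \<Rightarrow> ('i \<Rightarrow> 'i \<Rightarrow> bool) \<Rightarrow> ('i \<Rightarrow> 'e) \<Rightarrow> bool" where
  "Tc_Cauchy_net M E nrm D pre x \<longleftrightarrow> directed_on D pre \<and> x \<in> D \<rightarrow> carrier E \<and>
     (\<forall>\<epsilon>\<in>L0_pp M. \<exists>i\<in>D. \<forall>j\<in>D. \<forall>k\<in>D. pre i j \<longrightarrow> pre i k \<longrightarrow>
        L0_le M (nrm (x j \<ominus>\<^bsub>E\<^esub> x k)) \<epsilon>)"

text \<open>
  One cannot quantify over all index types inside a definition. Index type \<open>'e set \<times> 'e\<close>
  is large enough: \<open>Tc_complete_net\<close> derives convergence of Cauchy nets over every index type.
\<close>

definition Tc_complete ::
    "'w measure \<Rightarrow> ('e, 'm) ring_scheme \<Rightarrow> ('e \<Rightarrow> ('w \<Rightarrow> real) set) \<Rightarrow> bool" where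
  "Tc_complete M E nrm \<longleftrightarrow>
     (\<forall>(D :: ('e set \<times> 'e) set) pre x. Tc_Cauchy_net M E nrm D pre x
        \<longrightarrow> (\<exists>l. net_converges (Tc M E nrm) D pre x l))"

lemma Tc_complete_net:
  fixes D :: "'i set" and x :: "'i \<Rightarrow> 'e"
  assumes compl: "Tc_complete M E nrm" and cau: "Tc_Cauchy_net M E nrm D pre x"
  shows "\<exists>l. net_converges (Tc M E nrm) D pre x l"
proof -
  define tail where "tail i = x ` {j \<in> D. pre i j}" for i
  define D' where "D' = {(tail i, y) |i y. i \<in> D \<and> y \<in> tail i}"
  define pre' where "pre' = (\<lambda>(p::'e set \<times> 'e) (q::'e set \<times> 'e). fst q \<subseteq> fst p)"
  have dir: "directed_on D pre" and xD: "x \<in> D \<rightarrow> carrier E"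
    using cau by (auto simp: Tc_Cauchy_net_def)
  have refl: "pre i i" if "i \<in> D" for i using dir that by (auto simp: directed_on_def)
  have mono: "tail j \<subseteq> tail i" if "i \<in> D" "j \<in> D" "pre i j" for i j
  proof -
    have "pre i k" if "k \<in> D" "pre j k" for k
      using dir \<open>i \<in> D\<close> \<open>j \<in> D\<close> \<open>pre i j\<close> that unfolding directed_on_def by metis
    then show ?thesis by (auto simp: tail_def)
  qed
  have mem: "x j \<in> tail i" if "j \<in> D" "pre i j" for i j using that by (auto simp: tail_def)
  have "directed_on D' pre'"
    unfolding directed_on_def
  proof (intro conjI ballI impI)
    obtain i where "i \<in> D" using dir by (auto simp: directed_on_def)
    then have "(tail i, x i) \<in> D'" using mem refl by (auto simp: D'_def)
    then show "D' \<noteq> {}" by blast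
  next
    fix p q assume "p \<in> D'" "q \<in> D'"
    then obtain i j where ij: "i \<in> D" "j \<in> D" "fst p = tail i" "fst q = tail j"
      by (auto simp: D'_def)
    then obtain k where k: "k \<in> D" "pre i k" "pre j k" using dir unfolding directed_on_def by blast
    have "(tail k, x k) \<in> D'" using k mem refl by (auto simp: D'_def)
    moreover have "pre' p (tail k, x k)" "pre' q (tail k, x k)"
      by (simp_all add: pre'_def ij mono k)
    ultimately show "\<exists>r\<in>D'. pre' p r \<and> pre' q r" by blast
  qed (auto simp: pre'_def)
  moreover have "snd \<in> D' \<rightarrow> carrier E"
  proof
    fix p assume "p \<in> D'"
    then obtain j where "j \<in> D" "snd p = x j" by (auto simp: D'_def tail_def)
    then show "snd p \<in> carrier E" using funcset_mem[OF xD] by simp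
  qed
  moreover have "\<exists>p\<in>D'. \<forall>q\<in>D'. \<forall>r\<in>D'. pre' p q \<longrightarrow> pre' p r \<longrightarrow>
      L0_le M (nrm (snd q \<ominus>\<^bsub>E\<^esub> snd r)) \<epsilon>" if "\<epsilon> \<in> L0_pp M" for \<epsilon>
  proof -
    from cau that have "\<exists>i\<in>D. \<forall>j\<in>D. \<forall>k\<in>D. pre i j \<longrightarrow> pre i k \<longrightarrow> L0_le M (nrm (x j \<ominus>\<^bsub>E\<^esub> x k)) \<epsilon>"
      by (simp add: Tc_Cauchy_net_def)
    then obtain i where i: "i \<in> D"
      and le: "\<forall>j\<in>D. \<forall>k\<in>D. pre i j \<longrightarrow> pre i k \<longrightarrow> L0_le M (nrm (x j \<ominus>\<^bsub>E\<^esub> x k)) \<epsilon>" ..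
    have tl: "\<exists>j\<in>D. pre i j \<and> snd q = x j" if "q \<in> D'" "pre' (tail i, x i) q" for q
    proof -
      have "snd q \<in> fst q" using that(1) by (auto simp: D'_def)
      then have "snd q \<in> tail i" using that(2) by (auto simp: pre'_def)
      then show ?thesis by (auto simp: tail_def)
    qed
    show ?thesis
    proof (intro bexI[of _ "(tail i, x i)"] ballI impI)
      show "(tail i, x i) \<in> D'" using i mem refl by (auto simp: D'_def)
      fix q r assume "q \<in> D'" "r \<in> D'" "pre' (tail i, x i) q" "pre' (tail i, x i) r"
      then obtain j k where "j \<in> D" "pre i j" "snd q = x j" "k \<in> D" "pre i k" "snd r = x k"
        using tl by metis
      then show "L0_le M (nrm (snd q \<ominus>\<^bsub>E\<^esub> snd r)) \<epsilon>" using le by simp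
    qed
  qed
  ultimately have "Tc_Cauchy_net M E nrm D' pre' snd"
    by (simp add: Tc_Cauchy_net_def)
  then obtain l where l: "net_converges (Tc M E nrm) D' pre' snd l"
    using compl unfolding Tc_complete_def by blast
  have "net_converges (Tc M E nrm) D pre x l"
    unfolding net_converges_def
  proof (intro conjI allI impI)
    show "l \<in> topspace (Tc M E nrm)" using l by (simp add: net_converges_def)
    fix U assume "openin (Tc M E nrm) U \<and> l \<in> U"
    then obtain p where p: "p \<in> D'" "\<And>q. q \<in> D' \<Longrightarrow> pre' p q \<Longrightarrow> snd q \<in> U"
      using l unfolding net_converges_def by blast
    then obtain i where i: "i \<in> D" "fst p = tail i" by (auto simp: D'_def)
    have "x j \<in> U" if "j \<in> D" "pre i j" for j
    proof -
      have "(tail i, x j) \<in> D'" using i that mem by (auto simp: D'_def)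
      then show ?thesis using p(2)[of "(tail i, x j)"] i by (simp add: pre'_def)
    qed
    then show "\<exists>i\<in>D. \<forall>j\<in>D. pre i j \<longrightarrow> x j \<in> U" using i by blast
  qed
  then show ?thesis ..
qed


section \<open>The random conjugate space\<close>

text \<open>
  Functionals are extensional (equal to \<open>undefined\<close> off the carrier), so that equality of
  elements of \<open>L0_dual\<close> is equality on \<open>E\<close>.  The fields \<open>mult\<close> and \<open>one\<close> of a module record
  play no role.
\<close>

definition L0_dual :: "'w measure \<Rightarrow> (('w \<Rightarrow> 'k::real_or_complex) set, 'e) module
    \<Rightarrow> ('e \<Rightarrow> ('w \<Rightarrow> real) set) \<Rightarrow> (('w \<Rightarrow> 'k) set, 'e \<Rightarrow> ('w \<Rightarrow> 'k) set) module" where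
  "L0_dual M E nrm =
     \<lparr>carrier = {f \<in> carrier E \<rightarrow>\<^sub>E carrier (L0 M).
        (\<forall>x\<in>carrier E. \<forall>y\<in>carrier E. f (x \<oplus>\<^bsub>E\<^esub> y) = f x \<oplus>\<^bsub>L0 M\<^esub> f y) \<and>
        (\<forall>\<xi>\<in>carrier (L0 M). \<forall>x\<in>carrier E. f (\<xi> \<odot>\<^bsub>E\<^esub> x) = \<xi> \<otimes>\<^bsub>L0 M\<^esub> f x) \<and>
        continuous_map (Tc M E nrm) (Tc M (L0 M) (L0_abs M)) f},
      mult = undefined,
      one = undefined,
      zero = (\<lambda>x\<in>carrier E. \<zero>\<^bsub>L0 M\<^esub>),
      add = (\<lambda>f g. \<lambda>x\<in>carrier E. f x \<oplus>\<^bsub>L0 M\<^esub> g x),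
      smult = (\<lambda>\<xi> f. \<lambda>x\<in>carrier E. \<xi> \<otimes>\<^bsub>L0 M\<^esub> f x)\<rparr>"

definition L0_dual_norm :: "'w measure \<Rightarrow> (('w \<Rightarrow> 'k::real_or_complex) set, 'e) module
    \<Rightarrow> ('e \<Rightarrow> ('w \<Rightarrow> real) set) \<Rightarrow> ('e \<Rightarrow> ('w \<Rightarrow> 'k) set) \<Rightarrow> ('w \<Rightarrow> real) set" where
  "L0_dual_norm M E nrm f =
     \<Sqinter>\<^bsub>L0_order M\<^esub> {\<xi> \<in> L0_plus M. \<forall>x\<in>carrier E. L0_le M (L0_abs M (f x)) (\<xi> \<otimes>\<^bsub>L0 M\<^esub> nrm x)}"

definition riesz :: "(('w \<Rightarrow> 'k::real_or_complex) set, 'e) module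
    \<Rightarrow> ('e \<Rightarrow> 'e \<Rightarrow> ('w \<Rightarrow> 'k) set) \<Rightarrow> ('e \<Rightarrow> ('w \<Rightarrow> 'k) set) \<Rightarrow> 'e" where
  "riesz E ip f = (THE p. p \<in> carrier E \<and> (\<forall>x\<in>carrier E. f x = ip x p))"

end

theory Submission
  imports Defs
begin

text \<open>
  The representing element minimises the energy \<open>\<parallel>x\<parallel>\<^sup>2 - 2 Re f(x)\<close>, which is bounded below
  because a continuous functional satisfies \<open>|f(x)| \<le> c (1 + \<parallel>x\<parallel>)\<close>. By countable concatenation there
  are minimisers up to any positive random error, not only up to constants; this is what the
  random radii of the topology require. By the parallelogram law the carrier itself, directed by
  decreasing energy, is a Cauchy net. Varying a minimiser with error \<open>\<delta>\<close> in the direction \<open>z\<close> gives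
  \<open>|f(z) - \<langle>z, x\<rangle>|\<^sup>2 \<le> \<delta> \<parallel>z\<parallel>\<^sup>2\<close>, so the limit of the net represents \<open>f\<close>.
\<close>

section \<open>The scalar field\<close>

context
  fixes x y :: "'k::real_or_complex"
begin

lemma sc_conj_0 [simp]: "sc_conj (0::'k) = 0"
  using sc_conj_of_real[of 0, where 'k='k] by simp

lemma sc_conj_diff: "sc_conj (x - y) = sc_conj x - sc_conj y"
proof -
  have "sc_conj (x - y) + sc_conj y = sc_conj x"
    by (simp flip: sc_conj_add)
  then show ?thesis by (simp add: eq_diff_eq)
qed

text \<open>Isometry is not a class axiom: taking norms in \<open>mult_sc_conj\<close> and
  cancelling \<open>norm x\<close> yields it.\<close>

lemma norm_sc_conj [simp]: "norm (sc_conj x) = norm x"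
proof (cases "x = 0")
  case False
  have "norm x * norm (sc_conj x) = (norm x)\<^sup>2"
    by (simp flip: norm_mult add: mult_sc_conj del: of_real_power)
  with False show ?thesis by (simp add: power2_eq_square)
qed simp

text \<open>The sum \<open>x + sc_conj x\<close> is real, hence fixed by conjugation; cancelling the
  common summand \<open>sc_conj x\<close> leaves the claim.\<close>

lemma sc_conj_conj [simp]: "sc_conj (sc_conj x) = x"
proof -
  have "x + sc_conj x = sc_conj (x + sc_conj x)"
    by (simp only: add_sc_conj sc_conj_of_real)
  then show ?thesis by (simp add: sc_conj_add)
qed

lemma sc_re_add: "sc_re (x + y) = sc_re x + sc_re y"
proof -
  have "(of_real (2 * sc_re (x + y)) :: 'k) = of_real (2 * sc_re x) + of_real (2 * sc_re y)"
    by (simp only: sc_conj_add flip: add_sc_conj) simp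
  then have "(of_real (2 * sc_re (x + y)) :: 'k) = of_real (2 * sc_re x + 2 * sc_re y)"
    by simp
  then show ?thesis by (simp only: of_real_eq_iff)
qed

lemma sc_re_of_real_mult: "sc_re (of_real r * x) = r * sc_re x"
proof -
  have "(of_real (2 * sc_re (of_real r * x)) :: 'k) = of_real r * of_real (2 * sc_re x)"
    by (simp only: sc_conj_mult sc_conj_of_real flip: add_sc_conj distrib_left)
  then have "(of_real (2 * sc_re (of_real r * x)) :: 'k) = of_real (2 * (r * sc_re x))"
    by simp
  then show ?thesis by (simp only: of_real_eq_iff)
qed

lemma sc_re_minus: "sc_re (- x) = - sc_re x"
  using sc_re_of_real_mult[of "-1"] by simp

lemma abs_sc_re_le: "\<bar>sc_re x\<bar> \<le> norm x"
proof -
  have "norm (of_real (2 * sc_re x) :: 'k) \<le> norm x + norm x"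
    using norm_triangle_ineq[of x "sc_conj x"] by (simp only: add_sc_conj norm_sc_conj)
  then show ?thesis by (simp only: norm_of_real)
qed

lemma sc_conj_mult_self: "sc_conj x * x = of_real ((norm x)\<^sup>2)"
  by (simp add: mult_sc_conj mult.commute)

end

lemma sc_re_diff: "sc_re (x - y) = sc_re x - sc_re y"
  using sc_re_add[of x "- y"] by (simp add: sc_re_minus)

text \<open>Conjugation is additive and preserves norms, hence is continuous.\<close>

lemma borel_measurable_sc_conj [measurable]:
  "(sc_conj :: 'k::real_or_complex \<Rightarrow> 'k) \<in> borel_measurable borel"
proof (rule borel_measurable_continuous_onI)
  show "continuous_on UNIV (sc_conj :: 'k \<Rightarrow> 'k)"
    unfolding continuous_on_iff by (metis dist_norm norm_sc_conj sc_conj_diff)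
qed

lemma borel_measurable_sc_re [measurable]:
  "(sc_re :: 'k::real_or_complex \<Rightarrow> real) \<in> borel_measurable borel"
proof (rule borel_measurable_continuous_onI)
  show "continuous_on UNIV (sc_re :: 'k \<Rightarrow> real)"
    unfolding continuous_on_iff
    by (metis abs_sc_re_le dist_norm order_le_less_trans real_norm_def sc_re_diff)
qed


section \<open>Almost sure inequalities\<close>

text \<open>Pointwise this is the discriminant criterion, with optimal
  \<open>\<mu> = - sc_conj g / b\<close>. Here the null set depends on \<open>\<mu>\<close>, so only
  countably many test functions may be used, and \<open>b\<close> may vanish. The Cauchy-Schwarz
  inequality and the error bound for near minimisers both come from this criterion.\<close>

lemma AE_quadratic_discriminant:
  fixes a b :: "'w \<Rightarrow> real" and g :: "'w \<Rightarrow> 'k::real_or_complex"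
  assumes nonneg: "\<And>\<mu>. \<mu> \<in> borel_measurable M \<Longrightarrow>
      AE w in M. 0 \<le> a w + 2 * sc_re (\<mu> w * g w) + (norm (\<mu> w))\<^sup>2 * b w"
    and [measurable]: "g \<in> borel_measurable M" "b \<in> borel_measurable M"
    and b: "AE w in M. 0 \<le> b w"
  shows "AE w in M. (norm (g w))\<^sup>2 \<le> a w * b w"
proof -
  define t where "t n w = 1 / (b w + 1 / real (Suc n))" for n w
  have [measurable]: "t n \<in> borel_measurable M" for n unfolding t_def by measurable
  have "AE w in M. \<forall>n. 0 \<le> a w + 2 * sc_re ((- (of_real (t n w) * sc_conj (g w))) * g w)
      + (norm (- (of_real (t n w) * sc_conj (g w))))\<^sup>2 * b w"
    unfolding AE_all_countable by (intro allI nonneg) measurable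
  with b show ?thesis
  proof eventually_elim
    case (elim w)
    define G where "G = (norm (g w))\<^sup>2"
    have le: "G \<le> a w * (b w + 1 / real (Suc n))" for n
    proof -
      define s where "s = t n w"
      have pos: "0 < b w + 1 / real (Suc n)" using elim(1) by (simp add: add_nonneg_pos)
      then have s: "0 < s" "s * b w \<le> 1" "s * (b w + 1 / real (Suc n)) = 1"
        by (simp_all add: s_def t_def divide_simps)
      have "sc_re ((- (of_real s * sc_conj (g w))) * g w) = - (s * G)"
        by (simp add: sc_re_minus sc_conj_mult_self mult.assoc sc_re_of_real_mult G_def
            flip: of_real_power)
      moreover have "(norm (- (of_real s * sc_conj (g w))))\<^sup>2 = s\<^sup>2 * G"
        by (simp add: norm_mult power_mult_distrib G_def)
      ultimately have "0 \<le> a w - 2 * (s * G) + s\<^sup>2 * G * b w"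
        using elim(2)[rule_format, of n] by (simp add: s_def)
      \<comment> \<open>As \<open>s * b w \<le> 1\<close>, the quadratic term is at most
        \<open>s * G\<close> and uses up only one of the two copies subtracted.\<close>
      also have "s\<^sup>2 * G * b w = (s * G) * (s * b w)" by (simp add: power2_eq_square)
      also have "\<dots> \<le> (s * G) * 1"
        using s by (intro mult_left_mono) (auto simp: G_def)
      finally have "s * G \<le> a w" by linarith
      then have "s * G * (b w + 1 / real (Suc n)) \<le> a w * (b w + 1 / real (Suc n))"
        using pos by (intro mult_right_mono) auto
      moreover have "s * G * (b w + 1 / real (Suc n)) = G"
        using s(3) by (metis mult.assoc mult.commute mult.right_neutral)
      ultimately show ?thesis by (simp only:)
    qed
    have "(\<lambda>n. a w * (b w + 1 / real (Suc n))) \<longlonglongrightarrow> a w * (b w + 0)"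
      by (intro tendsto_intros LIMSEQ_Suc[OF lim_1_over_n])
    then show "(norm (g w))\<^sup>2 \<le> a w * b w"
      using le LIMSEQ_le_const unfolding G_def by fastforce
  qed
qed

text \<open>
  The bounded strictly increasing function \<open>arctan\<close> turns the search for the essential
  infimum into the minimisation of a real-valued integral.
\<close>

lemma (in prob_space) ex_random_near_minimizer:
  fixes \<phi> :: "'i \<Rightarrow> 'a \<Rightarrow> real"
  assumes "I \<noteq> {}"
    and meas: "\<And>i. i \<in> I \<Longrightarrow> \<phi> i \<in> borel_measurable M"
    and [measurable]: "b \<in> borel_measurable M" "\<epsilon> \<in> borel_measurable M"
    and bound: "\<And>i. i \<in> I \<Longrightarrow> AE w in M. b w \<le> \<phi> i w"
    and concat: "\<And>x n. range x \<subseteq> I \<Longrightarrow> n \<in> measurable M (count_space UNIV) \<Longrightarrow>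
      \<exists>i\<in>I. AE w in M. \<phi> i w = \<phi> (x (n w :: nat)) w"
    and pos: "AE w in M. 0 < \<epsilon> w"
  shows "\<exists>i\<in>I. \<forall>j\<in>I. AE w in M. \<phi> i w \<le> \<phi> j w + \<epsilon> w"
proof -
  define J where "J i = (\<integral>w. arctan (\<phi> i w) \<partial>M)" for i
  have arctan_bounded: "\<bar>arctan t\<bar> \<le> 2" for t
    using arctan_bounded[of t] pi_less_4 by (simp add: abs_le_iff)
  then have arctan_ge: "- 2 \<le> arctan t" for t using abs_le_D2 minus_le_iff by blast
  have arctan_meas: "(\<lambda>w. arctan (h w)) \<in> borel_measurable M"
    if [measurable]: "h \<in> borel_measurable M" for h
    by (rule measurable_compose[OF that borel_measurable_continuous_onI])
      (intro continuous_intros)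
  have arctan_int: "integrable M (\<lambda>w. arctan (h w))" if "h \<in> borel_measurable M" for h
    by (rule integrable_const_bound[where B=2]) (use that arctan_bounded arctan_meas in auto)
  have "-2 \<le> J i" if "i \<in> I" for i
  proof -
    have "(\<integral>w. - 2 \<partial>M) \<le> J i"
      unfolding J_def using arctan_ge arctan_int[OF meas[OF that]]
      by (intro integral_mono) auto
    then show ?thesis by (simp add: prob_space)
  qed
  then have bdd: "bdd_below (J ` I)" by (intro bdd_belowI2)
  define c where "c = (INF i\<in>I. J i)"
  have c_le: "c \<le> J i" if "i \<in> I" for i
    unfolding c_def using bdd that by (rule cINF_lower)
  have "\<exists>i\<in>I. J i < c + 1 / Suc k" for k :: nat
    using cINF_less_iff[OF \<open>I \<noteq> {}\<close> bdd, of "c + 1 / Suc k"] by (simp add: c_def)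
  then obtain x where x: "x k \<in> I" "J (x k) < c + 1 / Suc k" for k :: nat
    by metis
  have [measurable]: "\<phi> (x k) \<in> borel_measurable M" for k using meas x(1) by blast
  \<comment> \<open>Truncating at \<open>b\<close> makes the pointwise infimum exist everywhere.\<close>
  define \<psi> where "\<psi> k w = max (b w) (\<phi> (x k) w)" for k w
  have [measurable]: "\<psi> k \<in> borel_measurable M" for k unfolding \<psi>_def by measurable
  define m where "m w = (INF k. \<psi> k w)" for w
  have bdd_psi: "bdd_below (range (\<lambda>k. \<psi> k w))" for w
    by (rule bdd_belowI2[of _ "b w"]) (simp add: \<psi>_def)
  have [measurable]: "m \<in> borel_measurable M"
    unfolding m_def by (intro borel_measurable_cINF) (auto intro: bdd_psi)
  have "AE w in M. \<forall>k. b w \<le> \<phi> (x k) w"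
    unfolding AE_all_countable using bound x(1) by blast
  then have psi_eq: "AE w in M. \<forall>k. \<psi> k w = \<phi> (x k) w"
    by eventually_elim (simp add: \<psi>_def max_def)
  have m_le: "AE w in M. m w \<le> \<phi> j w" if j: "j \<in> I" for j
  proof -
    have [measurable]: "\<phi> j \<in> borel_measurable M" using meas j .
    \<comment> \<open>\<open>h\<close> is positive exactly where \<open>m\<close> exceeds
      \<open>\<phi> j\<close>, so the aim is to show that its integral vanishes.\<close>
    define h where "h w = max 0 (arctan (m w) - arctan (\<phi> j w))" for w
    have h_int: "integrable M h"
      unfolding h_def by (intro integrable_max Bochner_Integration.integrable_diff arctan_int) auto
    have "(\<integral>w. h w \<partial>M) \<le> 1 / Suc k" for k :: nat
    proof -
      \<comment> \<open>Gluing \<open>x k\<close> with \<open>j\<close> along the set where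
        \<open>j\<close> does better gives \<open>z\<close> with
        \<open>h \<le> arctan (\<phi> (x k)) - arctan (\<phi> z)\<close> almost surely. Since
        \<open>J (x k) < c + 1 / Suc k\<close> and \<open>c \<le> J z\<close>, the integral of
        \<open>h\<close>, which does not involve \<open>k\<close>, is at most
        \<open>1 / Suc k\<close>.\<close>
      define n where "n w = (if \<phi> j w < \<phi> (x k) w then 1 else 0 :: nat)" for w
      have "n \<in> measurable M (count_space UNIV)" unfolding n_def by measurable
      moreover have "range (\<lambda>i::nat. if i = 0 then x k else j) \<subseteq> I" using x(1) j by auto
      ultimately obtain z where z: "z \<in> I"
        "AE w in M. \<phi> z w = \<phi> (if n w = 0 then x k else j) w"
        using concat by blast
      have [measurable]: "\<phi> z \<in> borel_measurable M" using meas z(1) .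
      have "(\<integral>w. h w \<partial>M) \<le> (\<integral>w. arctan (\<phi> (x k) w) - arctan (\<phi> z w) \<partial>M)"
      proof (rule integral_mono_AE[OF h_int])
        show "integrable M (\<lambda>w. arctan (\<phi> (x k) w) - arctan (\<phi> z w))"
          by (intro Bochner_Integration.integrable_diff arctan_int) auto
        show "AE w in M. h w \<le> arctan (\<phi> (x k) w) - arctan (\<phi> z w)"
          using z(2) psi_eq
        proof eventually_elim
          case (elim w)
          have "m w \<le> \<psi> k w"
            unfolding m_def by (rule cINF_lower[OF bdd_psi]) simp
          then have "m w \<le> \<phi> (x k) w" using elim(2) by simp
          then show ?case using elim(1)
            by (auto simp: h_def n_def max_def arctan_le_iff arctan_less_iff split: if_splits)
        qed
      qed
      also have "\<dots> = J (x k) - J z"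
        unfolding J_def by (intro Bochner_Integration.integral_diff arctan_int) auto
      also have "\<dots> \<le> 1 / Suc k" using x(2)[of k] c_le[OF z(1)] by linarith
      finally show ?thesis .
    qed
    then have "(\<integral>w. h w \<partial>M) \<le> 0"
      using LIMSEQ_le_const[OF LIMSEQ_Suc[OF lim_1_over_n]] by blast
    moreover have h_nonneg: "0 \<le> h w" for w by (simp add: h_def)
    ultimately have "(\<integral>w. h w \<partial>M) = 0"
      by (intro antisym integral_nonneg_AE) auto
    then have "AE w in M. h w = 0"
      using integral_nonneg_eq_0_iff_AE[OF h_int] h_nonneg by simp
    then show ?thesis
      by eventually_elim (simp add: h_def max_def arctan_le_iff arctan_eq_iff split: if_splits)
  qed
  \<comment> \<open>The first member of the sequence within \<open>\<epsilon>\<close> of the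
    infimum, chosen separately at each point; it exists wherever \<open>\<epsilon>\<close> is
    positive. Its level sets are the countably many pieces to be glued.\<close>
  define n where "n w = (LEAST k. \<psi> k w < m w + \<epsilon> w)" for w
  have "n \<in> measurable M (count_space UNIV)" unfolding n_def by measurable
  moreover have "range x \<subseteq> I" using x(1) by auto
  ultimately obtain i where i: "i \<in> I" "AE w in M. \<phi> i w = \<phi> (x (n w)) w"
    using concat by blast
  have near: "AE w in M. \<phi> i w < m w + \<epsilon> w"
    using i(2) psi_eq pos
  proof eventually_elim
    case (elim w)
    then have "\<exists>k. \<psi> k w < m w + \<epsilon> w"
      using cINF_less_iff[OF UNIV_not_empty bdd_psi, of w "m w + \<epsilon> w"] by (simp add: m_def)
    then have "\<psi> (n w) w < m w + \<epsilon> w" unfolding n_def by (rule LeastI_ex)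
    then show ?case using elim by simp
  qed
  have "AE w in M. \<phi> i w \<le> \<phi> j w + \<epsilon> w" if "j \<in> I" for j
    using near m_le[OF that] by eventually_elim linarith
  then show ?thesis using i(1) by blast
qed

section \<open>Representatives\<close>

lemma L0_rep_measurable [measurable]:
  "X \<in> carrier (L0 M) \<Longrightarrow> L0_rep X \<in> borel_measurable M"
  by (elim L0_carrierE) (simp add: L0_rep_cls(1))

lemma L0_cls_rep: "X \<in> carrier (L0 M) \<Longrightarrow> L0_cls M (L0_rep X) = X"
  by (elim L0_carrierE) (auto intro!: L0_cls_eqI simp: L0_rep_cls(2))

text \<open>The passage from almost sure identities between representatives back to identities in
  \<open>L0 M\<close>.\<close>

lemma L0_eqI:
  assumes "X \<in> carrier (L0 M)" "Y \<in> carrier (L0 M)" "AE w in M. L0_rep X w = L0_rep Y w"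
  shows "X = Y"
  using L0_cls_eqI[OF assms(3)] by (simp add: assms(1,2) L0_cls_rep)

lemma AE_L0_rep_add:
  assumes "X \<in> carrier (L0 M)" "Y \<in> carrier (L0 M)"
  shows "AE w in M. L0_rep (X \<oplus>\<^bsub>L0 M\<^esub> Y) w = L0_rep X w + L0_rep Y w"
  using L0_rep_measurable[OF assms(1)] L0_rep_measurable[OF assms(2)]
  by (simp add: L0_def L0_rep_cls(2))

lemma AE_L0_rep_mult:
  assumes "X \<in> carrier (L0 M)" "Y \<in> carrier (L0 M)"
  shows "AE w in M. L0_rep (X \<otimes>\<^bsub>L0 M\<^esub> Y) w = L0_rep X w * L0_rep Y w"
  using L0_rep_measurable[OF assms(1)] L0_rep_measurable[OF assms(2)]
  by (simp add: L0_def L0_rep_cls(2))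

lemma AE_L0_rep_zero:
  "AE w in M. L0_rep (\<zero>\<^bsub>L0 M\<^esub> :: ('w \<Rightarrow> 'k::real_or_complex) set) w = 0"
  by (simp add: L0_zero L0_rep_cls(2))

lemma L0_map_carrier:
  assumes "X \<in> carrier (L0 M)" and [measurable]: "h \<in> borel_measurable borel"
  shows "L0_map M h X \<in> carrier (L0 M)"
  using L0_rep_measurable[OF assms(1)] by (auto simp: L0_map_def intro!: L0_cls_carrier)

lemma AE_L0_rep_map:
  assumes "X \<in> carrier (L0 M)" and [measurable]: "h \<in> borel_measurable borel"
  shows "AE w in M. L0_rep (L0_map M h X) w = h (L0_rep X w)"
  using L0_rep_measurable[OF assms(1)] by (simp add: L0_map_def L0_rep_cls(2))

lemma L0_plus_iff: "X \<in> L0_plus M \<longleftrightarrow> X \<in> carrier (L0 M) \<and> (AE w in M. 0 \<le> L0_rep X w)"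
proof -
  have "L0_le M \<zero>\<^bsub>L0 M\<^esub> X \<longleftrightarrow> (AE w in M. 0 \<le> L0_rep X w)"
    unfolding L0_le_def
    by (rule eventually_subst, use AE_L0_rep_zero[of M, where 'k=real] in eventually_elim) simp
  then show ?thesis by (simp add: L0_plus_def)
qed

lemma L0_pp_iff: "X \<in> L0_pp M \<longleftrightarrow> X \<in> carrier (L0 M) \<and> (AE w in M. 0 < L0_rep X w)"
  by (auto simp: L0_pp_def L0_plus_iff elim: eventually_mono)

lemma L0_cls_pp:
  assumes "h \<in> borel_measurable M" "AE w in M. 0 < h w"
  shows "L0_cls M h \<in> L0_pp M"
proof -
  have "AE w in M. 0 < L0_rep (L0_cls M h) w"
    using assms(2) L0_rep_cls(2)[OF assms(1)] by eventually_elim simp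
  then show ?thesis by (simp add: L0_pp_iff L0_cls_carrier assms(1))
qed


section \<open>Random inner products\<close>

context random_inner_product_module
begin

abbreviation nrm :: "'e \<Rightarrow> 'w \<Rightarrow> real" where
  "nrm x \<equiv> L0_rep (ip_norm M ip x)"

abbreviation sm :: "('w \<Rightarrow> 'k) \<Rightarrow> 'e \<Rightarrow> 'e" where
  "sm a x \<equiv> L0_cls M a \<odot>\<^bsub>E\<^esub> x"

lemma sm_closed: "a \<in> borel_measurable M \<Longrightarrow> x \<in> carrier E \<Longrightarrow> sm a x \<in> carrier E"
  by (intro smult_closed L0_cls_carrier)

lemma ip_norm_closed: "x \<in> carrier E \<Longrightarrow> ip_norm M ip x \<in> carrier (L0 M)"
  unfolding ip_norm_def by (intro L0_map_carrier ip_closed) auto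

lemma ip_rep_measurable [measurable]:
  "x \<in> carrier E \<Longrightarrow> y \<in> carrier E \<Longrightarrow> L0_rep (ip x y) \<in> borel_measurable M"
  by (intro L0_rep_measurable ip_closed)

lemma nrm_measurable [measurable]: "x \<in> carrier E \<Longrightarrow> nrm x \<in> borel_measurable M"
  by (intro L0_rep_measurable ip_norm_closed)

lemma AE_ip_self:
  assumes x: "x \<in> carrier E"
  shows "AE w in M. 0 \<le> nrm x w \<and> L0_rep (ip x x) w = of_real ((nrm x w)\<^sup>2)"
proof -
  obtain X where X: "X \<in> L0_plus M" "ip x x = L0_of_real M X"
    using ip_nonneg[OF x] by blast
  have *: "X \<in> carrier (L0 M)" "AE w in M. 0 \<le> L0_rep X w" using X(1) by (auto simp: L0_plus_iff)
  have "AE w in M. L0_rep (ip x x) w = of_real (L0_rep X w)"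
    unfolding X(2) by (intro AE_L0_rep_map *) auto
  moreover have "AE w in M. nrm x w = sqrt (sc_re (L0_rep (ip x x) w))"
    unfolding ip_norm_def by (intro AE_L0_rep_map ip_closed x) auto
  ultimately show ?thesis using *(2) by eventually_elim (simp flip: of_real_power)
qed

lemma AE_nrm_nonneg: "x \<in> carrier E \<Longrightarrow> AE w in M. 0 \<le> nrm x w"
  using AE_ip_self by auto

lemma ip_norm_plus: "x \<in> carrier E \<Longrightarrow> ip_norm M ip x \<in> L0_plus M"
  by (simp add: L0_plus_iff ip_norm_closed AE_nrm_nonneg)

section \<open>The inner product as an almost surely sesquilinear form\<close>

lemma AE_ip_conj:
  assumes "x \<in> carrier E" "y \<in> carrier E"
  shows "AE w in M. L0_rep (ip x y) w = sc_conj (L0_rep (ip y x) w)"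
  unfolding ip_conj[OF assms] by (intro AE_L0_rep_map ip_closed assms) auto

lemma AE_ip_add_left:
  assumes "x \<in> carrier E" "y \<in> carrier E" "z \<in> carrier E"
  shows "AE w in M. L0_rep (ip (x \<oplus>\<^bsub>E\<^esub> y) z) w = L0_rep (ip x z) w + L0_rep (ip y z) w"
  unfolding ip_add[OF assms] by (intro AE_L0_rep_add ip_closed assms)

lemma AE_ip_smult_left:
  assumes "\<xi> \<in> carrier (L0 M)" "x \<in> carrier E" "y \<in> carrier E"
  shows "AE w in M. L0_rep (ip (\<xi> \<odot>\<^bsub>E\<^esub> x) y) w = L0_rep \<xi> w * L0_rep (ip x y) w"
  unfolding ip_smult[OF assms] by (intro AE_L0_rep_mult ip_closed assms)

lemma AE_ip_add_right:
  assumes "x \<in> carrier E" "y \<in> carrier E" "z \<in> carrier E"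
  shows "AE w in M. L0_rep (ip z (x \<oplus>\<^bsub>E\<^esub> y)) w = L0_rep (ip z x) w + L0_rep (ip z y) w"
  using AE_ip_conj[OF assms(3) M.a_closed[OF assms(1,2)]] AE_ip_conj[OF assms(3,1)]
    AE_ip_conj[OF assms(3,2)] AE_ip_add_left[OF assms]
  by eventually_elim (simp add: sc_conj_add)

lemma AE_ip_diff_right:
  assumes "x \<in> carrier E" "y \<in> carrier E" "z \<in> carrier E"
  shows "AE w in M. L0_rep (ip z (x \<ominus>\<^bsub>E\<^esub> y)) w = L0_rep (ip z x) w - L0_rep (ip z y) w"
proof -
  have "x \<ominus>\<^bsub>E\<^esub> y \<oplus>\<^bsub>E\<^esub> y = x"
    using assms by (simp add: M.minus_eq M.a_assoc M.l_neg)
  then show ?thesis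
    using AE_ip_add_right[OF M.minus_closed[OF assms(1,2)] assms(2,3)] by auto
qed

lemma AE_ip_smult_right:
  assumes "\<xi> \<in> carrier (L0 M)" "x \<in> carrier E" "y \<in> carrier E"
  shows "AE w in M. L0_rep (ip y (\<xi> \<odot>\<^bsub>E\<^esub> x)) w = sc_conj (L0_rep \<xi> w) * L0_rep (ip y x) w"
  using AE_ip_conj[OF assms(3) smult_closed[OF assms(1,2)]] AE_ip_conj[OF assms(3,2)]
    AE_ip_smult_left[OF assms]
  by eventually_elim (simp add: sc_conj_mult)

lemma AE_ip_sm:
  assumes a: "a \<in> borel_measurable M" and "x \<in> carrier E" "y \<in> carrier E"
  shows "AE w in M. L0_rep (ip (sm a x) y) w = a w * L0_rep (ip x y) w"
    and "AE w in M. L0_rep (ip y (sm a x)) w = sc_conj (a w) * L0_rep (ip y x) w"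
  using AE_ip_smult_left[OF L0_cls_carrier[OF a] assms(2,3)]
    AE_ip_smult_right[OF L0_cls_carrier[OF a] assms(2,3)] L0_rep_cls(2)[OF a]
  by (eventually_elim, simp)+

section \<open>Homogeneity of the norm, Cauchy-Schwarz and triangle inequality\<close>

lemma AE_nrm_eqI:
  assumes "x \<in> carrier E"
    and "AE w in M. L0_rep (ip x x) w = of_real ((r w)\<^sup>2)" "AE w in M. 0 \<le> r w"
  shows "AE w in M. nrm x w = r w"
  using AE_ip_self[OF assms(1)] assms(2,3)
proof eventually_elim
  case (elim w)
  then have "(of_real ((nrm x w)\<^sup>2) :: 'k) = of_real ((r w)\<^sup>2)" by simp
  then have "(nrm x w)\<^sup>2 = (r w)\<^sup>2" by (simp only: of_real_eq_iff)
  then show ?case using elim by (simp add: power2_eq_iff_nonneg)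
qed

lemma AE_nrm_sm:
  assumes a: "a \<in> borel_measurable M" and x: "x \<in> carrier E"
  shows "AE w in M. nrm (sm a x) w = norm (a w) * nrm x w"
proof (rule AE_nrm_eqI[OF sm_closed[OF a x]])
  show "AE w in M. L0_rep (ip (sm a x) (sm a x)) w = of_real ((norm (a w) * nrm x w)\<^sup>2)"
    using AE_ip_sm(1)[OF a x sm_closed[OF a x]] AE_ip_sm(2)[OF a x x] AE_ip_self[OF x]
  proof eventually_elim
    case (elim w)
    have "a w * (sc_conj (a w) * of_real ((nrm x w)\<^sup>2)) = of_real ((norm (a w))\<^sup>2 * (nrm x w)\<^sup>2)"
      by (simp only: mult.assoc[symmetric] mult_sc_conj of_real_mult)
    then show ?case using elim by (simp add: power_mult_distrib)
  qed
  show "AE w in M. 0 \<le> norm (a w) * nrm x w"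
    using AE_nrm_nonneg[OF x] by eventually_elim simp
qed

text \<open>The cross term has \<open>y\<close> on the left, so that for
  \<open>y = sm \<mu> z\<close> the factor \<open>\<mu>\<close> comes out without
  conjugation.\<close>

lemma AE_nrm_add_square:
  assumes x: "x \<in> carrier E" and y: "y \<in> carrier E"
  shows "AE w in M. (nrm (x \<oplus>\<^bsub>E\<^esub> y) w)\<^sup>2
    = (nrm x w)\<^sup>2 + 2 * sc_re (L0_rep (ip y x) w) + (nrm y w)\<^sup>2"
  using AE_ip_add_left[OF x y M.a_closed[OF x y]] AE_ip_add_right[OF x y x]
    AE_ip_add_right[OF x y y] AE_ip_conj[OF x y]
    AE_ip_self[OF x] AE_ip_self[OF y] AE_ip_self[OF M.a_closed[OF x y]]
proof eventually_elim
  case (elim w)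
  let ?g = "L0_rep (ip y x) w"
  have "(of_real ((nrm (x \<oplus>\<^bsub>E\<^esub> y) w)\<^sup>2) :: 'k)
      = of_real ((nrm x w)\<^sup>2) + (?g + sc_conj ?g) + of_real ((nrm y w)\<^sup>2)"
    using elim by simp
  also have "\<dots> = of_real ((nrm x w)\<^sup>2 + 2 * sc_re ?g + (nrm y w)\<^sup>2)"
    by (simp add: add_sc_conj)
  finally show ?case by (simp only: of_real_eq_iff)
qed

text \<open>Nonnegativity of \<open>|y + \<mu> x|^2\<close> for every measurable
  \<open>\<mu>\<close> is the quadratic hypothesis of \<open>AE_quadratic_discriminant\<close>, with
  \<open>|y|^2\<close> and \<open>|x|^2\<close> as outer coefficients.\<close>

lemma AE_Cauchy_Schwarz:
  assumes x: "x \<in> carrier E" and y: "y \<in> carrier E"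
  shows "AE w in M. norm (L0_rep (ip x y) w) \<le> nrm x w * nrm y w"
proof -
  have "AE w in M. (norm (L0_rep (ip x y) w))\<^sup>2 \<le> (nrm y w)\<^sup>2 * (nrm x w)\<^sup>2"
  proof (rule AE_quadratic_discriminant)
    fix \<mu> :: "'w \<Rightarrow> 'k" assume mu: "\<mu> \<in> borel_measurable M"
    show "AE w in M. 0 \<le> (nrm y w)\<^sup>2 + 2 * sc_re (\<mu> w * L0_rep (ip x y) w)
        + (norm (\<mu> w))\<^sup>2 * (nrm x w)\<^sup>2"
      using AE_nrm_add_square[OF y sm_closed[OF mu x]] AE_ip_sm(1)[OF mu x y] AE_nrm_sm[OF mu x]
    proof eventually_elim
      case (elim w)
      show ?case
        using zero_le_power2[of "nrm (y \<oplus>\<^bsub>E\<^esub> sm \<mu> x) w"]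
        unfolding elim by (simp only: power_mult_distrib)
    qed
  qed (use x y in auto)
  then show ?thesis using AE_nrm_nonneg[OF x] AE_nrm_nonneg[OF y]
  proof eventually_elim
    case (elim w)
    have "(norm (L0_rep (ip x y) w))\<^sup>2 \<le> (nrm x w * nrm y w)\<^sup>2"
      using elim(1) by (simp only: power_mult_distrib mult.commute)
    then show ?case by (rule power2_le_imp_le) (use elim in auto)
  qed
qed

lemma AE_nrm_triangle:
  assumes x: "x \<in> carrier E" and y: "y \<in> carrier E"
  shows "AE w in M. nrm (x \<oplus>\<^bsub>E\<^esub> y) w \<le> nrm x w + nrm y w"
  using AE_nrm_add_square[OF x y] AE_Cauchy_Schwarz[OF y x] AE_nrm_nonneg[OF x] AE_nrm_nonneg[OF y]
proof eventually_elim
  case (elim w)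
  have "sc_re (L0_rep (ip y x) w) \<le> nrm y w * nrm x w"
    using elim(2) abs_sc_re_le order_trans abs_ge_self by meson
  then have "(nrm (x \<oplus>\<^bsub>E\<^esub> y) w)\<^sup>2 \<le> (nrm x w + nrm y w)\<^sup>2"
    using elim(1) by (simp add: power2_sum mult.commute)
  then show ?case by (rule power2_le_imp_le) (use elim in auto)
qed

lemma AE_nrm_zero: "AE w in M. nrm \<zero>\<^bsub>E\<^esub> w = 0"
  using AE_ip_self[OF M.zero_closed] AE_L0_rep_zero[of M, where 'k='k]
  by eventually_elim (simp add: iffD2[OF ip_eq_zero_iff])

text \<open>Testing with \<open>p - q\<close> itself gives
  \<open>\<langle>p - q, p - q\<rangle> = 0\<close>, and definiteness finishes.\<close>

lemma ip_right_unique: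
  assumes p: "p \<in> carrier E" and q: "q \<in> carrier E"
    and eq: "\<And>x. x \<in> carrier E \<Longrightarrow> ip x p = ip x q"
  shows "p = q"
proof -
  have d: "p \<ominus>\<^bsub>E\<^esub> q \<in> carrier E" (is "?d \<in> _") using p q by simp
  have "AE w in M. L0_rep (ip ?d ?d) w = L0_rep (\<zero>\<^bsub>L0 M\<^esub> :: ('w \<Rightarrow> 'k) set) w"
    using AE_ip_diff_right[OF p q d] AE_L0_rep_zero[of M, where 'k='k]
    by eventually_elim (simp add: eq[OF d])
  then have "ip ?d ?d = \<zero>\<^bsub>L0 M\<^esub>"
    by (rule L0_eqI[OF ip_closed[OF d d] R.zero_closed])
  then have "?d = \<zero>\<^bsub>E\<^esub>" using ip_eq_zero_iff d by blast
  moreover have "p = ?d \<oplus>\<^bsub>E\<^esub> q" using p q by (simp add: M.minus_eq M.a_assoc M.l_neg)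
  ultimately show ?thesis using q by simp
qed

end

section \<open>The locally \<open>L\<^sup>0\<close>-convex topology\<close>

lemma topspace_Tc:
  assumes "abelian_group E"
  shows "topspace (Tc M E nrm) = carrier E"
proof -
  interpret abelian_group E by fact
  \<comment> \<open>Openness of the carrier asks for at least one radius; the constant 1
    serves.\<close>
  have "L0_cls M (\<lambda>_. 1) \<in> L0_pp M" by (intro L0_cls_pp) auto
  then have "Tc_open M E nrm (carrier E)" unfolding Tc_open_def by auto
  moreover have "G \<subseteq> carrier E" if "Tc_open M E nrm G" for G using that by (simp add: Tc_open_def)
  ultimately show ?thesis unfolding topspace_def openin_Tc by blast
qed

text \<open>Stated for an abstract subadditive \<open>nrm\<close>, so that it covers both the module
  and \<open>L0 M\<close> with its absolute value. The strict inequality leaves a random gap at each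
  point, and that gap supplies the radius.\<close>

lemma openin_Tc_ball:
  assumes E: "abelian_group E" and l: "l \<in> carrier E"
    and closed: "\<And>x. x \<in> carrier E \<Longrightarrow> nrm x \<in> carrier (L0 M)"
    and triangle: "\<And>x y. x \<in> carrier E \<Longrightarrow> y \<in> carrier E \<Longrightarrow>
      AE w in M. L0_rep (nrm (x \<oplus>\<^bsub>E\<^esub> y)) w \<le> L0_rep (nrm x) w + L0_rep (nrm y) w"
    and [measurable]: "\<epsilon> \<in> borel_measurable M"
  shows "openin (Tc M E nrm) {x \<in> carrier E. AE w in M. L0_rep (nrm (x \<ominus>\<^bsub>E\<^esub> l)) w < \<epsilon> w}"
    (is "openin _ ?B")
proof -
  interpret abelian_group E by fact
  have "\<exists>\<delta>\<in>L0_pp M. {x \<oplus>\<^bsub>E\<^esub> y |y. y \<in> carrier E \<and> L0_le M (nrm y) \<delta>} \<subseteq> ?B"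
    if x: "x \<in> ?B" for x
  proof -
    have xE: "x \<in> carrier E" and lt: "AE w in M. L0_rep (nrm (x \<ominus>\<^bsub>E\<^esub> l)) w < \<epsilon> w" using x by auto
    \<comment> \<open>Half the gap: basic neighbourhoods are given by \<open>\<le>\<close>, so a
      radius equal to the whole gap could lose strictness.\<close>
    define r where "r w = (\<epsilon> w - L0_rep (nrm (x \<ominus>\<^bsub>E\<^esub> l)) w) / 2" for w
    have "L0_rep (nrm (x \<ominus>\<^bsub>E\<^esub> l)) \<in> borel_measurable M"
      by (intro L0_rep_measurable closed minus_closed xE l)
    then have r: "r \<in> borel_measurable M" unfolding r_def by measurable
    have r_pos: "AE w in M. 0 < r w" using lt by (simp add: r_def)
    have "x \<oplus>\<^bsub>E\<^esub> y \<in> ?B" if y: "y \<in> carrier E" "L0_le M (nrm y) (L0_cls M r)" for y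
    proof -
      have "x \<oplus>\<^bsub>E\<^esub> y \<ominus>\<^bsub>E\<^esub> l = (x \<ominus>\<^bsub>E\<^esub> l) \<oplus>\<^bsub>E\<^esub> y"
        using xE l y(1) by (simp add: minus_eq a_ac)
      then have "AE w in M. L0_rep (nrm (x \<oplus>\<^bsub>E\<^esub> y \<ominus>\<^bsub>E\<^esub> l)) w
          \<le> L0_rep (nrm (x \<ominus>\<^bsub>E\<^esub> l)) w + L0_rep (nrm y) w"
        using triangle[OF minus_closed[OF xE l] y(1)] by simp
      then have "AE w in M. L0_rep (nrm (x \<oplus>\<^bsub>E\<^esub> y \<ominus>\<^bsub>E\<^esub> l)) w < \<epsilon> w"
        using y(2)[unfolded L0_le_def] L0_rep_cls(2)[OF r] lt
      proof eventually_elim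
        case (elim w)
        then show ?case by (simp add: r_def field_simps)
      qed
      then show ?thesis using xE y(1) by simp
    qed
    then show ?thesis using L0_cls_pp[OF r r_pos] by blast
  qed
  then show ?thesis unfolding openin_Tc Tc_open_def by blast
qed

lemma L0_abs_triangle:
  assumes "X \<in> carrier (L0 M)" "Y \<in> carrier (L0 M)"
  shows "AE w in M. L0_rep (L0_abs M (X \<oplus>\<^bsub>L0 M\<^esub> Y)) w
    \<le> L0_rep (L0_abs M X) w + L0_rep (L0_abs M Y) w"
proof -
  interpret R: cring "L0 M :: ('a \<Rightarrow> 'b) set ring" by (rule cring_L0)
  show ?thesis
    using AE_L0_rep_map[OF R.a_closed[OF assms] borel_measurable_norm]
      AE_L0_rep_map[OF assms(1) borel_measurable_norm]
      AE_L0_rep_map[OF assms(2) borel_measurable_norm] AE_L0_rep_add[OF assms]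
    by eventually_elim (simp add: norm_triangle_ineq)
qed


section \<open>Minimising the energy of a bounded functional\<close>

text \<open>Serves to rescale by \<open>1 + n\<close> in place of \<open>n\<close>, which avoids
  dividing by a norm that may vanish on a set of positive measure.\<close>

lemma divide_one_plus_mult_le:
  fixes e n :: real
  assumes "0 \<le> e" "0 \<le> n"
  shows "e / (1 + n) * n \<le> e"
  using assms by (simp add: divide_simps distrib_left)

locale L0_functional = random_inner_product_module M E ip
  for M :: "'w measure" and E :: "(('w \<Rightarrow> 'k::real_or_complex) set, 'e) module" and ip +
  fixes f :: "'e \<Rightarrow> ('w \<Rightarrow> 'k) set"
  assumes f_closed: "x \<in> carrier E \<Longrightarrow> f x \<in> carrier (L0 M)"
    and f_add: "x \<in> carrier E \<Longrightarrow> y \<in> carrier E \<Longrightarrow> f (x \<oplus>\<^bsub>E\<^esub> y) = f x \<oplus>\<^bsub>L0 M\<^esub> f y"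
    and f_smult: "\<xi> \<in> carrier (L0 M) \<Longrightarrow> x \<in> carrier E \<Longrightarrow> f (\<xi> \<odot>\<^bsub>E\<^esub> x) = \<xi> \<otimes>\<^bsub>L0 M\<^esub> f x"
begin

lemma f_rep_measurable [measurable]: "x \<in> carrier E \<Longrightarrow> L0_rep (f x) \<in> borel_measurable M"
  by (intro L0_rep_measurable f_closed)

lemma AE_f_add:
  assumes "x \<in> carrier E" "y \<in> carrier E"
  shows "AE w in M. L0_rep (f (x \<oplus>\<^bsub>E\<^esub> y)) w = L0_rep (f x) w + L0_rep (f y) w"
  unfolding f_add[OF assms] by (intro AE_L0_rep_add f_closed assms)

lemma AE_f_sm:
  assumes a: "a \<in> borel_measurable M" and x: "x \<in> carrier E"
  shows "AE w in M. L0_rep (f (sm a x)) w = a w * L0_rep (f x) w"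
  unfolding f_smult[OF L0_cls_carrier[OF a] x]
  using AE_L0_rep_mult[OF L0_cls_carrier[OF a] f_closed[OF x]] L0_rep_cls(2)[OF a]
  by eventually_elim simp

lemma f_zero: "f \<zero>\<^bsub>E\<^esub> = \<zero>\<^bsub>L0 M\<^esub>"
  using f_smult[OF R.zero_closed M.zero_closed] f_closed[OF M.zero_closed] by simp

text \<open>If \<open>f\<close> is the inner product with \<open>p\<close>, this is
  \<open>|x - p|^2 - |p|^2\<close>, so its minimiser is the element sought.\<close>

definition energy :: "'e \<Rightarrow> 'w \<Rightarrow> real" where
  "energy x w = (nrm x w)\<^sup>2 - 2 * sc_re (L0_rep (f x) w)"

lemma energy_measurable [measurable]: "x \<in> carrier E \<Longrightarrow> energy x \<in> borel_measurable M"
  unfolding energy_def by measurable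

text \<open>The energy is quadratic, so the expansion is exact. Passing to the midpoint of two
  elements and varying in a direction are both instances.\<close>

lemma AE_energy_step:
  assumes x: "x \<in> carrier E" and z: "z \<in> carrier E" and mu: "\<mu> \<in> borel_measurable M"
  shows "AE w in M. energy (x \<oplus>\<^bsub>E\<^esub> sm \<mu> z) w = energy x w
    + 2 * sc_re (\<mu> w * (L0_rep (ip z x) w - L0_rep (f z) w)) + (norm (\<mu> w))\<^sup>2 * (nrm z w)\<^sup>2"
  using AE_nrm_add_square[OF x sm_closed[OF mu z]] AE_ip_sm(1)[OF mu z x] AE_nrm_sm[OF mu z]
    AE_f_add[OF x sm_closed[OF mu z]] AE_f_sm[OF mu z]
  by eventually_elim
    (simp add: energy_def power_mult_distrib sc_re_add sc_re_diff right_diff_distrib)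

text \<open>Concatenation is applied along the level sets of \<open>n\<close>. The energy is local:
  \<open>f\<close> and the norm are compatible with multiplication by indicators, so on each level
  set the energy depends only on the piece chosen there.\<close>

lemma energy_concat:
  assumes conc: "countable_concatenation M E" and x: "range x \<subseteq> carrier E"
    and n: "n \<in> measurable M (count_space UNIV)"
  shows "\<exists>y\<in>carrier E. AE w in M. energy y w = energy (x (n w :: nat)) w"
proof -
  define A where "A k = {w \<in> space M. n w = k}" for k
  have A: "A k \<in> sets M" for k
    using measurable_sets[OF n, of "{k}"] by (simp add: A_def vimage_def Int_def conj_commute)
  then have "range A \<subseteq> sets M" by blast
  moreover have "disjoint_family A" "(\<Union>k. A k) = space M"
    by (auto simp: A_def disjoint_family_on_def)
  ultimately obtain y where y: "y \<in> carrier E"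
      "\<And>k. sm (indicator (A k)) y = sm (indicator (A k)) (x k)"
    using conc[unfolded countable_concatenation_def, rule_format, OF x] by metis
  \<comment> \<open>One null set serves all \<open>k\<close>, so that \<open>k\<close> may
    afterwards be taken to be \<open>n w\<close>.\<close>
  have "AE w in M. \<forall>k. L0_rep (f y) w * indicator (A k) w = L0_rep (f (x k)) w * indicator (A k) w
      \<and> nrm y w * indicator (A k) w = nrm (x k) w * indicator (A k) w"
    unfolding AE_all_countable
  proof
    fix k
    have a: "(indicator (A k) :: 'w \<Rightarrow> 'k) \<in> borel_measurable M" using A by simp
    have xk: "x k \<in> carrier E" using x by auto
    have norm_ind: "norm (indicator (A k) w :: 'k) = indicator (A k) w" for w
      by (simp add: indicator_def)
    show "AE w in M. L0_rep (f y) w * indicator (A k) w = L0_rep (f (x k)) w * indicator (A k) w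
      \<and> nrm y w * indicator (A k) w = nrm (x k) w * indicator (A k) w"
      using AE_f_sm[OF a y(1)] AE_f_sm[OF a xk] AE_nrm_sm[OF a y(1)] AE_nrm_sm[OF a xk]
      by eventually_elim (auto simp: y(2) norm_ind)
  qed
  then have "AE w in M. energy y w = energy (x (n w)) w"
    using AE_space
  proof eventually_elim
    case (elim w)
    then have "w \<in> A (n w)" by (simp add: A_def)
    then show ?case using spec[OF elim(1), of "n w"] by (simp add: energy_def)
  qed
  with y(1) show ?thesis by blast
qed

text \<open>Continuity at zero gives a random radius on which \<open>|f| < 1\<close>; rescaling an
  arbitrary \<open>x\<close> into that ball and using homogeneity gives the bound. A bound affine in
  \<open>|x|\<close> is enough to bound the energy from below.\<close>

lemma continuous_imp_bounded:
  assumes "continuous_map (Tc M E (ip_norm M ip)) (Tc M (L0 M) (L0_abs M)) f"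
  obtains c where "c \<in> borel_measurable M"
    "\<And>x. x \<in> carrier E \<Longrightarrow> AE w in M. norm (L0_rep (f x) w) \<le> c w * (1 + nrm x w)"
proof -
  define U :: "('w \<Rightarrow> 'k) set set" where
    "U = {X \<in> carrier (L0 M). AE w in M. L0_rep (L0_abs M (X \<ominus>\<^bsub>L0 M\<^esub> \<zero>\<^bsub>L0 M\<^esub>)) w < 1}"
  have "openin (Tc M (L0 M) (L0_abs M)) U"
    unfolding U_def
    by (intro openin_Tc_ball L0_map_carrier L0_abs_triangle R.abelian_group_axioms R.zero_closed) auto
  then have op: "Tc_open M E (ip_norm M ip) {x \<in> carrier E. f x \<in> U}"
    using openin_continuous_map_preimage[OF assms]
    by (simp add: openin_Tc topspace_Tc M.abelian_group_axioms)
  have U_lt: "AE w in M. norm (L0_rep X w) < 1" if "X \<in> U" for X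
  proof -
    have X: "X \<in> carrier (L0 M)" "AE w in M. L0_rep (L0_abs M X) w < 1"
      using that by (auto simp: U_def R.minus_eq)
    from X(2) AE_L0_rep_map[OF X(1) borel_measurable_norm] show ?thesis
      by eventually_elim simp
  qed
  have "AE w in M. L0_rep (L0_abs M (\<zero>\<^bsub>L0 M\<^esub> :: ('w \<Rightarrow> 'k) set)) w < 1"
    using AE_L0_rep_map[OF R.zero_closed borel_measurable_norm] AE_L0_rep_zero[of M, where 'k='k]
    by eventually_elim simp
  then have "\<zero>\<^bsub>E\<^esub> \<in> {x \<in> carrier E. f x \<in> U}"
    by (simp add: f_zero U_def R.minus_eq)
  then obtain \<epsilon> where eps: "\<epsilon> \<in> L0_pp M"
    "{\<zero>\<^bsub>E\<^esub> \<oplus>\<^bsub>E\<^esub> y |y. y \<in> carrier E \<and> L0_le M (ip_norm M ip y) \<epsilon>} \<subseteq> {x \<in> carrier E. f x \<in> U}"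
    using op unfolding Tc_open_def by blast
  have ball: "f y \<in> U" if "y \<in> carrier E" "L0_le M (ip_norm M ip y) \<epsilon>" for y
    using eps(2) that by force
  define e where "e = L0_rep \<epsilon>"
  have e [measurable]: "e \<in> borel_measurable M" "AE w in M. 0 < e w"
    using eps(1) by (auto simp: e_def L0_pp_iff)
  show thesis
  proof
    show "(\<lambda>w. 1 / e w) \<in> borel_measurable M" by measurable
    fix x assume x [measurable]: "x \<in> carrier E"
    \<comment> \<open>This factor moves \<open>x\<close> into the ball of radius \<open>e\<close>.
      Dividing \<open>|f| < 1\<close> by it yields the constant \<open>1 / e\<close>.\<close>
    define a :: "'w \<Rightarrow> 'k" where "a w = of_real (e w / (1 + nrm x w))" for w
    have a: "a \<in> borel_measurable M" unfolding a_def by measurable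
    have norm_a: "norm (a w) = \<bar>e w / (1 + nrm x w)\<bar>" for w
      unfolding a_def by (rule norm_of_real)
    have "AE w in M. nrm (sm a x) w \<le> e w"
      using AE_nrm_sm[OF a x] AE_nrm_nonneg[OF x] e(2)
    proof eventually_elim
      case (elim w)
      then have "nrm (sm a x) w = e w / (1 + nrm x w) * nrm x w" by (simp add: norm_a)
      also have "\<dots> \<le> e w" using elim by (intro divide_one_plus_mult_le) auto
      finally show ?case .
    qed
    then have "AE w in M. norm (L0_rep (f (sm a x)) w) < 1"
      by (intro U_lt ball sm_closed a x) (simp add: L0_le_def e_def)
    then show "AE w in M. norm (L0_rep (f x) w) \<le> 1 / e w * (1 + nrm x w)"
      using AE_f_sm[OF a x] AE_nrm_nonneg[OF x] e(2)
      by eventually_elim (simp add: norm_a norm_mult field_simps)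
  qed
qed

text \<open>Completing the square, the energy is at least
  \<open>|x|^2 - 2 c (1 + |x|) = (|x| - c)^2 - c^2 - 2 c\<close>. This supplies the common
  measurable lower bound; gluing is provided by \<open>energy_concat\<close>.\<close>

lemma ex_near_minimizer:
  assumes conc: "countable_concatenation M E"
    and c [measurable]: "c \<in> borel_measurable M"
    and bound: "\<And>x. x \<in> carrier E \<Longrightarrow> AE w in M. norm (L0_rep (f x) w) \<le> c w * (1 + nrm x w)"
    and \<epsilon>: "\<epsilon> \<in> borel_measurable M" "AE w in M. 0 < \<epsilon> w"
  shows "\<exists>x\<in>carrier E. \<forall>y\<in>carrier E. AE w in M. energy x w \<le> energy y w + \<epsilon> w"
proof (rule ex_random_near_minimizer[where b = "\<lambda>w. - (c w)\<^sup>2 - 2 * c w"])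
  show "AE w in M. - (c w)\<^sup>2 - 2 * c w \<le> energy x w" if "x \<in> carrier E" for x
    using bound[OF that]
  proof eventually_elim
    case (elim w)
    have "sc_re (L0_rep (f x) w) \<le> c w * (1 + nrm x w)"
      using elim abs_sc_re_le abs_ge_self order_trans by meson
    moreover have "0 \<le> (nrm x w - c w)\<^sup>2" by simp
    ultimately show ?case by (simp add: energy_def power2_diff algebra_simps)
  qed
qed (use energy_concat[OF conc] \<epsilon> M.zero_closed in auto)

text \<open>The parallelogram law at the midpoint \<open>h\<close> reads
  \<open>energy x + energy y - 2 energy h = |y - x|^2 / 2\<close>. The left side is at most
  \<open>2 \<delta>\<close>, because neither energy exceeds that of \<open>h\<close> by more than
  \<open>\<delta>\<close>.\<close>

lemma near_minimizers_close:
  assumes x: "x \<in> carrier E" and y: "y \<in> carrier E"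
    and "\<And>z. z \<in> carrier E \<Longrightarrow> AE w in M. energy x w \<le> energy z w + \<delta> w"
    and "\<And>z. z \<in> carrier E \<Longrightarrow> AE w in M. energy y w \<le> energy z w + \<delta> w"
  shows "AE w in M. (nrm (y \<ominus>\<^bsub>E\<^esub> x) w)\<^sup>2 \<le> 4 * \<delta> w"
proof -
  define z where "z = y \<ominus>\<^bsub>E\<^esub> x"
  define h where "h = x \<oplus>\<^bsub>E\<^esub> sm (\<lambda>_. of_real (1/2)) z"
  have z: "z \<in> carrier E" using x y by (simp add: z_def)
  then have h: "h \<in> carrier E" unfolding h_def by (intro M.a_closed sm_closed x) auto
  have "x \<oplus>\<^bsub>E\<^esub> sm (\<lambda>_. 1) z = y"
    using x y z by (simp flip: L0_one) (simp add: z_def M.minus_eq M.a_lcomm[of x y] M.r_neg)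
  then have *: "AE w in M. energy y w = energy x w
      + 2 * sc_re (L0_rep (ip z x) w - L0_rep (f z) w) + (nrm z w)\<^sup>2"
    using AE_energy_step[OF x z, of "\<lambda>_. 1"] by simp
  have "AE w in M. energy h w = energy x w
      + sc_re (L0_rep (ip z x) w - L0_rep (f z) w) + (nrm z w)\<^sup>2 / 4"
    using AE_energy_step[OF x z, of "\<lambda>_. of_real (1/2)"] unfolding h_def sc_re_of_real_mult
    by (simp add: power2_eq_square)
  with * assms(3)[OF h] assms(4)[OF h] show ?thesis
    unfolding z_def[symmetric] by eventually_elim linarith
qed

text \<open>Comparing \<open>x\<close> with every \<open>x + \<mu> z\<close> through
  \<open>AE_energy_step\<close> produces a nonnegative quadratic expression in \<open>\<mu>\<close>
  with constant term \<open>\<delta>\<close>; its discriminant gives the estimate.\<close>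

lemma near_minimizer_represents:
  assumes x: "x \<in> carrier E" and z: "z \<in> carrier E"
    and min: "\<And>y. y \<in> carrier E \<Longrightarrow> AE w in M. energy x w \<le> energy y w + \<delta> w"
  shows "AE w in M. (norm (L0_rep (ip z x) w - L0_rep (f z) w))\<^sup>2 \<le> \<delta> w * (nrm z w)\<^sup>2"
proof (rule AE_quadratic_discriminant)
  fix \<mu> :: "'w \<Rightarrow> 'k" assume mu: "\<mu> \<in> borel_measurable M"
  show "AE w in M. 0 \<le> \<delta> w + 2 * sc_re (\<mu> w * (L0_rep (ip z x) w - L0_rep (f z) w))
      + (norm (\<mu> w))\<^sup>2 * (nrm z w)\<^sup>2"
    using AE_energy_step[OF x z mu] min[OF M.a_closed[OF x sm_closed[OF mu z]]]
    by eventually_elim linarith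
qed (use x z in auto)

end

section \<open>The representing element\<close>

context L0_functional
begin

lemma ex_representing_element:
  assumes compl: "Tc_complete M E (ip_norm M ip)" and conc: "countable_concatenation M E"
    and cont: "continuous_map (Tc M E (ip_norm M ip)) (Tc M (L0 M) (L0_abs M)) f"
  shows "\<exists>p\<in>carrier E. \<forall>z\<in>carrier E. f z = ip z p"
proof -
  obtain c where c: "c \<in> borel_measurable M"
    "\<And>x. x \<in> carrier E \<Longrightarrow> AE w in M. norm (L0_rep (f x) w) \<le> c w * (1 + nrm x w)"
    using continuous_imp_bounded[OF cont] by blast
  \<comment> \<open>Later elements have lower energy almost surely. Two elements need not be
    comparable, but gluing supplies a common successor.\<close>
  define pre where "pre x y \<longleftrightarrow> (AE w in M. energy y w \<le> energy x w)" for x y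
  have directed: "\<exists>z\<in>carrier E. pre x z \<and> pre y z" if x: "x \<in> carrier E" and y: "y \<in> carrier E" for x y
  proof -
    \<comment> \<open>Gluing along the set where \<open>y\<close> has less energy realises the
      pointwise minimum of the two energies.\<close>
    define n where "n w = (if energy y w < energy x w then 1 else 0 :: nat)" for w
    have "range (\<lambda>i::nat. if i = 0 then x else y) \<subseteq> carrier E" using x y by auto
    moreover have "n \<in> measurable M (count_space UNIV)"
      unfolding n_def using x y by measurable
    ultimately obtain z where z: "z \<in> carrier E"
      "AE w in M. energy z w = energy (if n w = 0 then x else y) w"
      using energy_concat[OF conc] by blast
    have "pre x z" "pre y z"
      unfolding pre_def using z(2) by (eventually_elim, auto simp: n_def split: if_splits)+
    with z(1) show ?thesis by blast
  qed
  have trans: "pre x z" if "pre x y" "pre y z" for x y z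
    using that unfolding pre_def by eventually_elim linarith
  have dir: "directed_on (carrier E) pre"
    unfolding directed_on_def
  proof (intro conjI ballI impI)
    show "carrier E \<noteq> {}" using M.zero_closed by blast
    show "pre i i" for i by (simp add: pre_def)
  qed (rule trans directed; assumption)+
  \<comment> \<open>Near minimality passes to every later element, so a single near minimiser
    controls a whole tail.\<close>
  have near: "\<exists>x\<in>carrier E. \<forall>j\<in>carrier E. pre x j \<longrightarrow>
      (\<forall>z\<in>carrier E. AE w in M. energy j w \<le> energy z w + \<delta> w)"
    if \<delta>: "\<delta> \<in> borel_measurable M" "AE w in M. 0 < \<delta> w" for \<delta>
  proof -
    obtain x where x: "x \<in> carrier E"
        "\<And>z. z \<in> carrier E \<Longrightarrow> AE w in M. energy x w \<le> energy z w + \<delta> w"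
      using ex_near_minimizer[OF conc c \<delta>] by blast
    have "AE w in M. energy j w \<le> energy z w + \<delta> w" if "pre x j" "z \<in> carrier E" for j z
      using that(1)[unfolded pre_def] x(2)[OF that(2)] by eventually_elim linarith
    with x(1) show ?thesis by blast
  qed
  \<comment> \<open>With the carrier as index set and the identity as net, all random errors are
    handled at once, without selecting a minimiser for each of them.\<close>
  have "Tc_Cauchy_net M E (ip_norm M ip) (carrier E) pre (\<lambda>x. x)"
    unfolding Tc_Cauchy_net_def
  proof (intro conjI ballI dir)
    fix \<epsilon> assume "\<epsilon> \<in> L0_pp M"
    then have e: "L0_rep \<epsilon> \<in> borel_measurable M" "AE w in M. 0 < L0_rep \<epsilon> w"
      by (auto simp: L0_pp_iff)
    \<comment> \<open>Chosen so that the bound \<open>4 * \<delta>\<close> on the squared distance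
      becomes the square of the radius.\<close>
    define \<delta> where "\<delta> w = (L0_rep \<epsilon> w)\<^sup>2 / 4" for w
    have "\<delta> \<in> borel_measurable M" unfolding \<delta>_def using e(1) by measurable
    moreover have "AE w in M. 0 < \<delta> w" using e(2) by eventually_elim (simp add: \<delta>_def)
    ultimately obtain x where x: "x \<in> carrier E"
      "\<And>j z. j \<in> carrier E \<Longrightarrow> pre x j \<Longrightarrow> z \<in> carrier E \<Longrightarrow>
        AE w in M. energy j w \<le> energy z w + \<delta> w"
      using near by meson
    have "L0_le M (ip_norm M ip (j \<ominus>\<^bsub>E\<^esub> k)) \<epsilon>"
      if "j \<in> carrier E" "k \<in> carrier E" "pre x j" "pre x k" for j k
    proof -
      have "AE w in M. (nrm (j \<ominus>\<^bsub>E\<^esub> k) w)\<^sup>2 \<le> 4 * \<delta> w"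
        using that x(2) by (intro near_minimizers_close) auto
      then show ?thesis
        unfolding L0_le_def using e(2)
      proof eventually_elim
        case (elim w)
        then show ?case by (intro power2_le_imp_le[of "nrm (j \<ominus>\<^bsub>E\<^esub> k) w"]) (auto simp: \<delta>_def)
      qed
    qed
    then show "\<exists>i\<in>carrier E. \<forall>j\<in>carrier E. \<forall>k\<in>carrier E. pre i j \<longrightarrow> pre i k \<longrightarrow>
        L0_le M (ip_norm M ip (j \<ominus>\<^bsub>E\<^esub> k)) \<epsilon>"
      using x(1) by blast
  qed simp
  then obtain p where p: "net_converges (Tc M E (ip_norm M ip)) (carrier E) pre (\<lambda>x. x) p"
    using Tc_complete_net[OF compl] by blast
  have pE: "p \<in> carrier E"
    using p by (simp add: net_converges_def topspace_Tc M.abelian_group_axioms)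
  \<comment> \<open>Constant errors suffice from here on: letting \<open>\<epsilon>\<close> run
    through \<open>1 / Suc n\<close> forces equality almost surely.\<close>
  have approx: "AE w in M. norm (L0_rep (f z) w - L0_rep (ip z p) w) \<le> nrm z w * (2 * \<epsilon>)"
    if z: "z \<in> carrier E" and "0 < \<epsilon>" for z and \<epsilon> :: real
  proof -
    define B where "B = {x \<in> carrier E. AE w in M. nrm (x \<ominus>\<^bsub>E\<^esub> p) w < \<epsilon>}"
    have "openin (Tc M E (ip_norm M ip)) B"
      unfolding B_def
      by (intro openin_Tc_ball M.abelian_group_axioms pE ip_norm_closed AE_nrm_triangle) auto
    moreover have "p \<ominus>\<^bsub>E\<^esub> p = \<zero>\<^bsub>E\<^esub>" using pE by (simp add: M.minus_eq M.r_neg)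
    then have "p \<in> B" using pE AE_nrm_zero \<open>0 < \<epsilon>\<close> by (auto simp: B_def)
    ultimately have "\<exists>i\<in>carrier E. \<forall>j\<in>carrier E. pre i j \<longrightarrow> j \<in> B"
      by (intro conjunct2[OF p[unfolded net_converges_def], rule_format] conjI)
    then obtain i where i: "i \<in> carrier E" "\<And>j. j \<in> carrier E \<Longrightarrow> pre i j \<Longrightarrow> j \<in> B"
      by blast
    obtain x where x: "x \<in> carrier E"
      "\<And>j z. j \<in> carrier E \<Longrightarrow> pre x j \<Longrightarrow> z \<in> carrier E \<Longrightarrow>
        AE w in M. energy j w \<le> energy z w + \<epsilon>\<^sup>2"
      using near[of "\<lambda>_. \<epsilon>\<^sup>2"] \<open>0 < \<epsilon>\<close> by auto
    \<comment> \<open>An element later than both \<open>i\<close> and \<open>x\<close> is close to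
      \<open>p\<close> and a near minimiser at once. Each of these facts costs
      \<open>|z| \<epsilon>\<close>, whence the factor 2.\<close>
    obtain j where j: "j \<in> carrier E" "pre i j" "pre x j"
      using directed[OF i(1) x(1)] by blast
    have "AE w in M. (norm (L0_rep (ip z j) w - L0_rep (f z) w))\<^sup>2 \<le> \<epsilon>\<^sup>2 * (nrm z w)\<^sup>2"
      using near_minimizer_represents[OF j(1) z x(2)[OF j(1,3)]] .
    moreover have "AE w in M. nrm (j \<ominus>\<^bsub>E\<^esub> p) w < \<epsilon>"
      using i(2)[OF j(1,2)] by (simp add: B_def)
    moreover note AE_Cauchy_Schwarz[OF z M.minus_closed[OF j(1) pE]] AE_nrm_nonneg[OF z]
      AE_ip_diff_right[OF j(1) pE z]
    ultimately show ?thesis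
    proof eventually_elim
      case (elim w)
      have "(norm (L0_rep (ip z j) w - L0_rep (f z) w))\<^sup>2 \<le> (nrm z w * \<epsilon>)\<^sup>2"
        using elim(1) by (simp only: power_mult_distrib mult.commute)
      then have "norm (L0_rep (ip z j) w - L0_rep (f z) w) \<le> nrm z w * \<epsilon>"
        by (rule power2_le_imp_le) (use elim \<open>0 < \<epsilon>\<close> in simp)
      moreover have "norm (L0_rep (ip z j) w - L0_rep (ip z p) w) \<le> nrm z w * \<epsilon>"
        using elim(3) mult_left_mono[OF less_imp_le[OF elim(2)] elim(4)] unfolding elim(5)
        by linarith
      moreover have "norm (L0_rep (f z) w - L0_rep (ip z p) w)
          \<le> norm (L0_rep (ip z j) w - L0_rep (ip z p) w)
            + norm (L0_rep (ip z j) w - L0_rep (f z) w)"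
        using norm_triangle_ineq4[of "L0_rep (ip z j) w - L0_rep (ip z p) w"
            "L0_rep (ip z j) w - L0_rep (f z) w"] by simp
      ultimately show ?case by (simp add: distrib_left)
    qed
  qed
  have "f z = ip z p" if z: "z \<in> carrier E" for z
  proof (rule L0_eqI[OF f_closed[OF z] ip_closed[OF z pE]])
    have "AE w in M. \<forall>n. norm (L0_rep (f z) w - L0_rep (ip z p) w) \<le> nrm z w * (2 * (1 / Suc n))"
      unfolding AE_all_countable by (intro allI approx[OF z]) simp
    then show "AE w in M. L0_rep (f z) w = L0_rep (ip z p) w"
    proof eventually_elim
      case (elim w)
      have "(\<lambda>n. nrm z w * (2 * (1 / real (Suc n)))) \<longlonglongrightarrow> nrm z w * (2 * 0)"
        by (intro tendsto_intros LIMSEQ_Suc[OF lim_1_over_n])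
      then have "norm (L0_rep (f z) w - L0_rep (ip z p) w) \<le> nrm z w * (2 * 0)"
        by (rule LIMSEQ_le_const) (use elim in blast)
      then show ?case by simp
    qed
  qed
  with pE show ?thesis by blast
qed

end

section \<open>The random conjugate space\<close>

text \<open>The lattice infimum is picked by \<open>SOME\<close> among greatest lower bounds. A
  least element of \<open>A\<close> is one of them, and antisymmetry on classes shows that it is the
  only one.\<close>

lemma L0_order_inf_eq:
  assumes "a \<in> A" "A \<subseteq> carrier (L0 M)" "\<And>b. b \<in> A \<Longrightarrow> L0_le M a b"
  shows "\<Sqinter>\<^bsub>L0_order M\<^esub> A = a"
  unfolding inf_def
proof (rule some_equality)
  show greatest: "greatest (L0_order M) a (Lower (L0_order M) A)"
    using assms by (auto simp: greatest_def Lower_def L0_order_def)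
  fix b assume "greatest (L0_order M) b (Lower (L0_order M) A)"
  with greatest have b: "b \<in> carrier (L0 M)" and le: "L0_le M a b" "L0_le M b a"
    by (auto simp: greatest_def Lower_def L0_order_def)
  have "AE w in M. L0_rep b w = L0_rep a w"
    using le unfolding L0_le_def by eventually_elim simp
  then show "b = a" using b assms(1,2) by (intro L0_eqI) auto
qed

context random_inner_product_module
begin

abbreviation dual :: "(('w \<Rightarrow> 'k) set, 'e \<Rightarrow> ('w \<Rightarrow> 'k) set) module" where
  "dual \<equiv> L0_dual M E (ip_norm M ip)"

lemma dual_functional: "f \<in> carrier dual \<Longrightarrow> L0_functional M E ip f"
  by (intro L0_functional.intro random_inner_product_module_axioms L0_functional_axioms.intro)
    (auto simp: L0_dual_def)

lemma dual_continuous: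
  "f \<in> carrier dual \<Longrightarrow> continuous_map (Tc M E (ip_norm M ip)) (Tc M (L0 M) (L0_abs M)) f"
  by (simp add: L0_dual_def)

lemma dual_extensional: "f \<in> carrier dual \<Longrightarrow> f \<in> extensional (carrier E)"
  by (auto simp: L0_dual_def PiE_def)

section \<open>The second slot of the inner product, and the functionals it defines\<close>

lemma ip_smult_right:
  assumes "\<xi> \<in> carrier (L0 M)" "x \<in> carrier E" "y \<in> carrier E"
  shows "ip y (\<xi> \<odot>\<^bsub>E\<^esub> x) = L0_conj M \<xi> \<otimes>\<^bsub>L0 M\<^esub> ip y x"
proof (rule L0_eqI)
  have c: "L0_conj M \<xi> \<in> carrier (L0 M)" by (intro L0_map_carrier assms) auto
  then show "L0_conj M \<xi> \<otimes>\<^bsub>L0 M\<^esub> ip y x \<in> carrier (L0 M)"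
    by (intro R.m_closed ip_closed assms)
  show "AE w in M. L0_rep (ip y (\<xi> \<odot>\<^bsub>E\<^esub> x)) w = L0_rep (L0_conj M \<xi> \<otimes>\<^bsub>L0 M\<^esub> ip y x) w"
    using AE_ip_smult_right[OF assms] AE_L0_rep_mult[OF c ip_closed[OF assms(3,2)]]
      AE_L0_rep_map[OF assms(1) borel_measurable_sc_conj]
    by eventually_elim simp
qed (intro ip_closed smult_closed assms)

lemma ip_add_right:
  assumes "x \<in> carrier E" "y \<in> carrier E" "z \<in> carrier E"
  shows "ip z (x \<oplus>\<^bsub>E\<^esub> y) = ip z x \<oplus>\<^bsub>L0 M\<^esub> ip z y"
proof (rule L0_eqI)
  show "AE w in M. L0_rep (ip z (x \<oplus>\<^bsub>E\<^esub> y)) w = L0_rep (ip z x \<oplus>\<^bsub>L0 M\<^esub> ip z y) w"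
    using AE_ip_add_right[OF assms] AE_L0_rep_add[OF ip_closed[OF assms(3,1)] ip_closed[OF assms(3,2)]]
    by eventually_elim simp
qed (intro ip_closed M.a_closed R.a_closed assms)+

text \<open>Needed for surjectivity of the representation. Continuity at each point comes from
  Cauchy-Schwarz, with a random radius adapted to the norm of \<open>p\<close>.\<close>

lemma ip_in_dual:
  assumes p: "p \<in> carrier E"
  shows "(\<lambda>x\<in>carrier E. ip x p) \<in> carrier dual"
proof -
  let ?f = "\<lambda>x\<in>carrier E. ip x p"
  have "continuous_map (Tc M E (ip_norm M ip)) (Tc M (L0 M) (L0_abs M)) ?f"
    unfolding continuous_map_def
  proof (intro conjI allI impI)
    show "?f \<in> topspace (Tc M E (ip_norm M ip)) \<rightarrow> topspace (Tc M (L0 M) (L0_abs M))"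
      using p by (auto simp: topspace_Tc M.abelian_group_axioms R.abelian_group_axioms ip_closed)
    fix U :: "('w \<Rightarrow> 'k) set set" assume "openin (Tc M (L0 M) (L0_abs M)) U"
    then have U: "Tc_open M (L0 M) (L0_abs M) U" by (simp add: openin_Tc)
    let ?V = "{x \<in> carrier E. ?f x \<in> U}"
    have "\<exists>\<delta>\<in>L0_pp M. {x \<oplus>\<^bsub>E\<^esub> y |y. y \<in> carrier E \<and> L0_le M (ip_norm M ip y) \<delta>} \<subseteq> ?V"
      if "x \<in> ?V" for x
    proof -
      have x: "x \<in> carrier E" "ip x p \<in> U" using that by auto
      then obtain \<epsilon> where eps: "\<epsilon> \<in> L0_pp M"
        "{ip x p \<oplus>\<^bsub>L0 M\<^esub> Y |Y. Y \<in> carrier (L0 M) \<and> L0_le M (L0_abs M Y) \<epsilon>} \<subseteq> U"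
        using U unfolding Tc_open_def by blast
      define e where "e = L0_rep \<epsilon>"
      have e: "e \<in> borel_measurable M" "AE w in M. 0 < e w"
        using eps(1) by (auto simp: e_def L0_pp_iff)
      \<comment> \<open>For \<open>|y| \<le> d\<close>, Cauchy-Schwarz gives
        \<open>|\<langle>y, p\<rangle>| \<le> d |p| \<le> e\<close>; the summand 1 takes care of the
        set where \<open>|p|\<close> vanishes.\<close>
      define d where "d w = e w / (1 + nrm p w)" for w
      have d: "d \<in> borel_measurable M" unfolding d_def using e(1) p by measurable
      have d_pos: "AE w in M. 0 < d w"
        using e(2) AE_nrm_nonneg[OF p] by eventually_elim (simp add: d_def)
      have "x \<oplus>\<^bsub>E\<^esub> y \<in> ?V" if y: "y \<in> carrier E" "L0_le M (ip_norm M ip y) (L0_cls M d)" for y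
      proof -
        have "L0_le M (L0_abs M (ip y p)) \<epsilon>"
          unfolding L0_le_def
          using y(2)[unfolded L0_le_def] L0_rep_cls(2)[OF d] AE_Cauchy_Schwarz[OF y(1) p]
            AE_L0_rep_map[OF ip_closed[OF y(1) p] borel_measurable_norm] AE_nrm_nonneg[OF p] e(2)
        proof eventually_elim
          case (elim w)
          have "nrm y w * nrm p w \<le> d w * nrm p w"
            using elim by (intro mult_right_mono) auto
          also have "\<dots> \<le> e w"
            unfolding d_def using elim by (intro divide_one_plus_mult_le) auto
          finally show ?case using elim by (simp add: e_def)
        qed
        then have "ip (x \<oplus>\<^bsub>E\<^esub> y) p \<in> U"
          unfolding ip_add[OF x(1) y(1) p] using eps(2) ip_closed[OF y(1) p] by blast
        then show ?thesis using x(1) y(1) by simp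
      qed
      then show ?thesis using L0_cls_pp[OF d d_pos] by blast
    qed
    then have "Tc_open M E (ip_norm M ip) ?V" unfolding Tc_open_def by blast
    then show "openin (Tc M E (ip_norm M ip)) {x \<in> topspace (Tc M E (ip_norm M ip)). ?f x \<in> U}"
      by (simp add: openin_Tc topspace_Tc M.abelian_group_axioms)
  qed
  then show ?thesis
    using p by (simp add: L0_dual_def ip_closed ip_add ip_smult)
qed

text \<open>The infimum is attained: Cauchy-Schwarz makes \<open>|p|\<close> an admissible bound,
  and any admissible \<open>\<xi>\<close>, tested at \<open>p\<close>, satisfies
  \<open>|p|^2 \<le> \<xi> |p|\<close>.\<close>

lemma dual_norm_eq:
  assumes p: "p \<in> carrier E" and f: "\<And>x. x \<in> carrier E \<Longrightarrow> f x = ip x p"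
  shows "L0_dual_norm M E (ip_norm M ip) f = ip_norm M ip p"
  unfolding L0_dual_norm_def
proof (rule L0_order_inf_eq)
  have abs: "AE w in M. L0_rep (L0_abs M (f x)) w = norm (L0_rep (ip x p) w)" if "x \<in> carrier E" for x
    unfolding f[OF that] by (rule AE_L0_rep_map[OF ip_closed[OF that p] borel_measurable_norm])
  have "L0_le M (L0_abs M (f x)) (ip_norm M ip p \<otimes>\<^bsub>L0 M\<^esub> ip_norm M ip x)" if x: "x \<in> carrier E" for x
    unfolding L0_le_def
    using abs[OF x] AE_Cauchy_Schwarz[OF x p]
      AE_L0_rep_mult[OF ip_norm_closed[OF p] ip_norm_closed[OF x]]
    by eventually_elim (simp add: mult.commute)
  then show "ip_norm M ip p \<in> {\<xi> \<in> L0_plus M. \<forall>x\<in>carrier E.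
      L0_le M (L0_abs M (f x)) (\<xi> \<otimes>\<^bsub>L0 M\<^esub> ip_norm M ip x)}"
    using p by (simp add: ip_norm_plus)
  fix \<xi> assume "\<xi> \<in> {\<xi> \<in> L0_plus M. \<forall>x\<in>carrier E.
      L0_le M (L0_abs M (f x)) (\<xi> \<otimes>\<^bsub>L0 M\<^esub> ip_norm M ip x)}"
  then have xi: "\<xi> \<in> carrier (L0 M)" "AE w in M. 0 \<le> L0_rep \<xi> w"
    and "L0_le M (L0_abs M (f p)) (\<xi> \<otimes>\<^bsub>L0 M\<^esub> ip_norm M ip p)"
    using p by (auto simp: L0_plus_iff)
  from this(3) show "L0_le M (ip_norm M ip p) \<xi>"
    unfolding L0_le_def
    using AE_L0_rep_mult[OF xi(1) ip_norm_closed[OF p]] abs[OF p] AE_ip_self[OF p] xi(2)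
  proof eventually_elim
    case (elim w)
    have "norm (L0_rep (ip p p) w) = (nrm p w)\<^sup>2" using elim(4) by (simp only: norm_of_real) simp
    then have "nrm p w * nrm p w \<le> L0_rep \<xi> w * nrm p w"
      using elim by (simp add: power2_eq_square)
    \<comment> \<open>Cancelling \<open>|p|\<close> is possible only where it is positive; where it
      vanishes, \<open>\<xi> \<ge> 0\<close> suffices.\<close>
    then show ?case using elim by (cases "nrm p w = 0") (auto simp: mult_le_cancel_right)
  qed
qed (auto simp: L0_plus_iff)

text \<open>\<open>riesz\<close> is a definite description, so exhibiting a representing element
  computes it; \<open>ip_right_unique\<close> excludes a second one.\<close>

lemma riesz_eqI:
  assumes "p \<in> carrier E" "\<And>x. x \<in> carrier E \<Longrightarrow> f x = ip x p"
  shows "riesz E ip f = p"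
  unfolding riesz_def
proof (rule the_equality)
  show "p \<in> carrier E \<and> (\<forall>x\<in>carrier E. f x = ip x p)" using assms by blast
  show "q = p" if "q \<in> carrier E \<and> (\<forall>x\<in>carrier E. f x = ip x q)" for q
    using that by (intro ip_right_unique assms(1)) (auto simp flip: assms(2))
qed

end

theorem theorem4p3:
  fixes M :: "'w measure"
    and E :: "(('w \<Rightarrow> 'k::real_or_complex) set, 'e) module"
    and ip :: "'e \<Rightarrow> 'e \<Rightarrow> ('w \<Rightarrow> 'k) set"
  assumes "random_inner_product_module M E ip"
    and "Tc_complete M E (ip_norm M ip)"
    and "countable_concatenation M E"
  shows "(\<forall>f\<in>carrier (L0_dual M E (ip_norm M ip)).
            (\<exists>!p. p \<in> carrier E \<and> (\<forall>x\<in>carrier E. f x = ip x p)) \<and>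
            L0_dual_norm M E (ip_norm M ip) f = ip_norm M ip (riesz E ip f)) \<and>
         bij_betw (riesz E ip) (carrier (L0_dual M E (ip_norm M ip))) (carrier E) \<and>
         (\<forall>\<xi>\<in>carrier (L0 M). \<forall>\<eta>\<in>carrier (L0 M).
          \<forall>f\<in>carrier (L0_dual M E (ip_norm M ip)). \<forall>g\<in>carrier (L0_dual M E (ip_norm M ip)).
            riesz E ip (\<xi> \<odot>\<^bsub>L0_dual M E (ip_norm M ip)\<^esub> f \<oplus>\<^bsub>L0_dual M E (ip_norm M ip)\<^esub>
                        \<eta> \<odot>\<^bsub>L0_dual M E (ip_norm M ip)\<^esub> g) =
            L0_conj M \<xi> \<odot>\<^bsub>E\<^esub> riesz E ip f \<oplus>\<^bsub>E\<^esub> L0_conj M \<eta> \<odot>\<^bsub>E\<^esub> riesz E ip g)"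
proof -
  interpret random_inner_product_module M E ip by fact
  have ex: "\<exists>p\<in>carrier E. \<forall>x\<in>carrier E. f x = ip x p" if "f \<in> carrier dual" for f
    using L0_functional.ex_representing_element[OF dual_functional[OF that] assms(2,3)
        dual_continuous[OF that]] .
  have riesz: "riesz E ip f \<in> carrier E" "\<And>x. x \<in> carrier E \<Longrightarrow> f x = ip x (riesz E ip f)"
    if f: "f \<in> carrier dual" for f
  proof -
    obtain p where p: "p \<in> carrier E" "\<And>x. x \<in> carrier E \<Longrightarrow> f x = ip x p"
      using ex[OF f] by blast
    then have "riesz E ip f = p" by (rule riesz_eqI)
    then show "riesz E ip f \<in> carrier E" "\<And>x. x \<in> carrier E \<Longrightarrow> f x = ip x (riesz E ip f)"
      using p by simp_all
  qed
  have unique: "\<exists>!p. p \<in> carrier E \<and> (\<forall>x\<in>carrier E. f x = ip x p)" if "f \<in> carrier dual" for f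
  proof (rule ex1I)
    show "riesz E ip f \<in> carrier E \<and> (\<forall>x\<in>carrier E. f x = ip x (riesz E ip f))"
      using riesz[OF that] by blast
  qed (use riesz_eqI in blast)
  have norm: "L0_dual_norm M E (ip_norm M ip) f = ip_norm M ip (riesz E ip f)"
    if "f \<in> carrier dual" for f
    using riesz[OF that] by (rule dual_norm_eq)
  have bij: "bij_betw (riesz E ip) (carrier dual) (carrier E)"
  proof (rule bij_betw_imageI)
    show "inj_on (riesz E ip) (carrier dual)"
    proof (rule inj_onI)
      fix f g assume f: "f \<in> carrier dual" and g: "g \<in> carrier dual"
        and eq: "riesz E ip f = riesz E ip g"
      \<comment> \<open>A common representing element gives agreement on the carrier only;
        extensionality settles the remaining arguments.\<close>
      show "f = g"
        by (rule extensionalityI[OF dual_extensional[OF f] dual_extensional[OF g]])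
          (simp add: riesz(2)[OF f] riesz(2)[OF g] eq)
    qed
    have "riesz E ip (\<lambda>x\<in>carrier E. ip x p) = p" if "p \<in> carrier E" for p
      using that by (intro riesz_eqI) auto
    then show "riesz E ip ` carrier dual = carrier E"
      using riesz(1) ip_in_dual by (force intro: image_eqI)
  qed
  have conj_linear: "riesz E ip (\<xi> \<odot>\<^bsub>dual\<^esub> f \<oplus>\<^bsub>dual\<^esub> \<eta> \<odot>\<^bsub>dual\<^esub> g)
      = L0_conj M \<xi> \<odot>\<^bsub>E\<^esub> riesz E ip f \<oplus>\<^bsub>E\<^esub> L0_conj M \<eta> \<odot>\<^bsub>E\<^esub> riesz E ip g"
    if \<xi>: "\<xi> \<in> carrier (L0 M)" and \<eta>: "\<eta> \<in> carrier (L0 M)"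
      and f: "f \<in> carrier dual" and g: "g \<in> carrier dual" for \<xi> \<eta> f g
  proof (rule riesz_eqI)
    \<comment> \<open>Scalars leave the second slot conjugated, so the conjugated coefficients come
      out as \<open>\<xi>\<close> and \<open>\<eta>\<close> once conjugation is known to be an
      involution on classes.\<close>
    have conj: "L0_conj M \<zeta> \<in> carrier (L0 M)" "L0_conj M (L0_conj M \<zeta>) = \<zeta>"
      if "\<zeta> \<in> carrier (L0 M)" for \<zeta> :: "('w \<Rightarrow> 'k) set"
    proof -
      show c: "L0_conj M \<zeta> \<in> carrier (L0 M)" by (intro L0_map_carrier that) auto
      show "L0_conj M (L0_conj M \<zeta>) = \<zeta>"
      proof (rule L0_eqI[OF _ that])
        show "L0_conj M (L0_conj M \<zeta>) \<in> carrier (L0 M)" by (intro L0_map_carrier c) auto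
        show "AE w in M. L0_rep (L0_conj M (L0_conj M \<zeta>)) w = L0_rep \<zeta> w"
          using AE_L0_rep_map[OF c borel_measurable_sc_conj]
            AE_L0_rep_map[OF that borel_measurable_sc_conj]
          by eventually_elim simp
      qed
    qed
    show "L0_conj M \<xi> \<odot>\<^bsub>E\<^esub> riesz E ip f \<oplus>\<^bsub>E\<^esub> L0_conj M \<eta> \<odot>\<^bsub>E\<^esub> riesz E ip g \<in> carrier E"
      by (intro M.a_closed smult_closed conj \<xi> \<eta> riesz(1) f g)
    fix x assume x: "x \<in> carrier E"
    have "(\<xi> \<odot>\<^bsub>dual\<^esub> f \<oplus>\<^bsub>dual\<^esub> \<eta> \<odot>\<^bsub>dual\<^esub> g) x
        = \<xi> \<otimes>\<^bsub>L0 M\<^esub> ip x (riesz E ip f) \<oplus>\<^bsub>L0 M\<^esub> \<eta> \<otimes>\<^bsub>L0 M\<^esub> ip x (riesz E ip g)"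
      using x by (simp add: L0_dual_def flip: riesz(2)[OF f x] riesz(2)[OF g x])
    also have "\<dots> = ip x (L0_conj M \<xi> \<odot>\<^bsub>E\<^esub> riesz E ip f \<oplus>\<^bsub>E\<^esub> L0_conj M \<eta> \<odot>\<^bsub>E\<^esub> riesz E ip g)"
      by (simp add: ip_add_right ip_smult_right conj \<xi> \<eta> riesz(1) f g x)
    finally show "(\<xi> \<odot>\<^bsub>dual\<^esub> f \<oplus>\<^bsub>dual\<^esub> \<eta> \<odot>\<^bsub>dual\<^esub> g) x
        = ip x (L0_conj M \<xi> \<odot>\<^bsub>E\<^esub> riesz E ip f \<oplus>\<^bsub>E\<^esub> L0_conj M \<eta> \<odot>\<^bsub>E\<^esub> riesz E ip g)" .
  qed
  show ?thesis by (intro conjI ballI unique norm bij conj_linear)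
qed

end
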